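(* Let $X=(X_t)_{t=0,1,2,\ldots}$ be a time-reversible ergodic discrete-time Markov chain on $\{0,1,\ldots,n\}$ ($n\ge 1$) with transition matrix $P$ and stationary distribution $\pi$. Let $1=\lambda_0>\lambda_1>\cdots>\lambda_r$ and $\gamma_1>\cdots>\gamma_r$ be the reduced eigenvalues of $P$ and of $P_0$, respectively, and assume $\lambda_r\ge 0$. Let $T_0=\min\{t\ge 0: X_t=0\}$. Then the law of $T_0$ when $X_0\sim\pi$ is the law of $\sum_{i=1}^r Y_i$, where $Y_1,Y_2,\ldots,Y_r$ are independent with the "modified Geometric" distributions $$Y_i\sim \frac{1-\gamma_i}{1-\lambda_i}\,\delta_0+\left(1-\frac{1-\gamma_i}{1-\lambda_i}\right)\mathrm{Geo}(1-\gamma_i),\qquad i=1,\ldots,r,$$ i.e. $Y_i$ is distributed as the mixture, with the displayed weights, of unit mass at $0$ and the distribution $\mathrm{Geo}(1-\gamma_i)$.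
   Context: Ergodic means irreducible and aperiodic; time-reversible means $\pi(i)P(i,j)=\pi(j)P(j,i)$ for all $i,j$. $P_0$ denotes the $n\times n$ principal submatrix of $P$ obtained by deleting row $0$ and column $0$. By reversibility $P$ and $P_0$ have real eigenvalues. Reduced eigenvalues: regard the spectra $\sigma(P)$ ($n+1$ elements) and $\sigma(P_0)$ ($n$ elements) as multisets and remove the multiset $\sigma(P)\cap\sigma(P_0)$ from each. The remaining eigenvalues of $P$ are labelled $\lambda_0\ge\lambda_1\ge\cdots\ge\lambda_r$ and those of $P_0$ are labelled $\gamma_1\ge\cdots\ge\gamma_r$; they strictly interlace: $1=\lambda_0>\gamma_1>\lambda_1>\cdots>\gamma_r>\lambda_r>-1$. $\mathrm{Geo}(p)$ is the distribution with mass $p(1-p)^{k-1}$ at $k=1,2,\ldots$. *)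

theory Defs
  imports "HOL-Probability.Probability" "Jordan_Normal_Form.Char_Poly"
begin

definition stochastic_matrix :: "nat \<Rightarrow> real mat \<Rightarrow> bool" where
  "stochastic_matrix n P \<longleftrightarrow>
     P \<in> carrier_mat (n + 1) (n + 1) \<and>
     (\<forall>i\<in>{0..n}. \<forall>j\<in>{0..n}. 0 \<le> P $$ (i, j)) \<and>
     (\<forall>i\<in>{0..n}. (\<Sum>j\<in>{0..n}. P $$ (i, j)) = 1)"

definition irreducible_matrix :: "nat \<Rightarrow> real mat \<Rightarrow> bool" where
  "irreducible_matrix n P \<longleftrightarrow>
     (\<forall>i\<in>{0..n}. \<forall>j\<in>{0..n}. \<exists>k. 0 < (P ^\<^sub>m k) $$ (i, j))"

definition aperiodic_matrix :: "nat \<Rightarrow> real mat \<Rightarrow> bool" where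
  "aperiodic_matrix n P \<longleftrightarrow>
     (\<forall>i\<in>{0..n}. Gcd {k. 1 \<le> k \<and> 0 < (P ^\<^sub>m k) $$ (i, i)} = 1)"

definition ergodic_matrix :: "nat \<Rightarrow> real mat \<Rightarrow> bool" where
  "ergodic_matrix n P \<longleftrightarrow>
     stochastic_matrix n P \<and> irreducible_matrix n P \<and> aperiodic_matrix n P"

definition stationary_distribution :: "nat \<Rightarrow> real mat \<Rightarrow> (nat \<Rightarrow> real) \<Rightarrow> bool" where
  "stationary_distribution n P \<pi> \<longleftrightarrow>
     (\<forall>i\<in>{0..n}. 0 \<le> \<pi> i) \<and> (\<Sum>i\<in>{0..n}. \<pi> i) = 1 \<and>
     (\<forall>j\<in>{0..n}. (\<Sum>i\<in>{0..n}. \<pi> i * P $$ (i, j)) = \<pi> j)"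

definition time_reversible :: "nat \<Rightarrow> real mat \<Rightarrow> (nat \<Rightarrow> real) \<Rightarrow> bool" where
  "time_reversible n P \<pi> \<longleftrightarrow>
     (\<forall>i\<in>{0..n}. \<forall>j\<in>{0..n}. \<pi> i * P $$ (i, j) = \<pi> j * P $$ (j, i))"

text \<open>The Markov property is required only for histories of positive probability, where the
  conditional probability is meaningful.\<close>

definition markov_chain ::
  "nat \<Rightarrow> real mat \<Rightarrow> (nat \<Rightarrow> real) \<Rightarrow> 'w measure \<Rightarrow> (nat \<Rightarrow> 'w \<Rightarrow> nat) \<Rightarrow> bool" where
  "markov_chain n P \<mu> M X \<longleftrightarrow>
     prob_space M \<and>
     (\<forall>t. X t \<in> measurable M (count_space {0..n})) \<and>
     (\<forall>i\<in>{0..n}. \<P>(\<omega> in M. X 0 \<omega> = i) = \<mu> i) \<and>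
     (\<forall>t x. \<forall>j\<in>{0..n}. \<P>(\<omega> in M. \<forall>s\<le>t. X s \<omega> = x s) \<noteq> 0 \<longrightarrow>
        \<P>(\<omega> in M. X (Suc t) \<omega> = j \<bar> \<forall>s\<le>t. X s \<omega> = x s) = P $$ (x t, j))"

text \<open>The hitting time is \<open>\<infinity>\<close> on paths that never visit \<open>0\<close>.\<close>

definition hitting_time_zero :: "(nat \<Rightarrow> 'w \<Rightarrow> nat) \<Rightarrow> 'w \<Rightarrow> enat" where
  "hitting_time_zero X \<omega> = Inf (enat ` {t. X t \<omega> = 0})"

text \<open>Real eigenvalues with algebraic multiplicity. For a reversible ergodic \<open>P\<close> and its
  principal submatrices all complex eigenvalues are real, so nothing is lost.\<close>

definition eigenvalue_mset :: "real mat \<Rightarrow> real multiset" where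
  "eigenvalue_mset A = proots (char_poly A)"

abbreviation delete_zero :: "real mat \<Rightarrow> real mat" where
  "delete_zero P \<equiv> mat_delete P 0 0"

definition common_eigenvalues :: "real mat \<Rightarrow> real multiset" where
  "common_eigenvalues P = eigenvalue_mset P \<inter># eigenvalue_mset (delete_zero P)"

definition reduced_lambdas :: "real mat \<Rightarrow> real multiset" where
  "reduced_lambdas P = eigenvalue_mset P - common_eigenvalues P"

definition reduced_gammas :: "real mat \<Rightarrow> real multiset" where
  "reduced_gammas P = eigenvalue_mset (delete_zero P) - common_eigenvalues P"

definition num_reduced :: "real mat \<Rightarrow> nat" where
  "num_reduced P = size (reduced_gammas P)"

text \<open>Both families are listed in decreasing order; \<open>\<lambda>\<close> is indexed by \<open>0, \<dots>, r\<close> and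
  \<open>\<gamma>\<close> by \<open>1, \<dots>, r\<close>, where \<open>r = num_reduced P\<close>.\<close>

definition reduced_lambda :: "real mat \<Rightarrow> nat \<Rightarrow> real" where
  "reduced_lambda P i = rev (sorted_list_of_multiset (reduced_lambdas P)) ! i"

definition reduced_gamma :: "real mat \<Rightarrow> nat \<Rightarrow> real" where
  "reduced_gamma P i = rev (sorted_list_of_multiset (reduced_gammas P)) ! (i - 1)"

text \<open>\<open>geometric_pmf\<close> lives on \<open>0, 1, \<dots>\<close>; the law \<open>Geo(p)\<close> used here lives on \<open>1, 2, \<dots>\<close>.\<close>

definition Geo :: "real \<Rightarrow> nat pmf" where
  "Geo p = map_pmf Suc (geometric_pmf p)"

text \<open>The mixture \<open>w \<delta>\<^sub>0 + (1 - w) Geo(1 - g)\<close> with \<open>w = (1 - g) / (1 - l)\<close>. It has this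
  meaning for \<open>0 \<le> g < 1\<close> and \<open>l \<le> g\<close>, which holds for \<open>l = \<lambda>\<^sub>i\<close> and \<open>g = \<gamma>\<^sub>i\<close> when
  \<open>\<lambda>\<^sub>r \<ge> 0\<close>, by the strict interlacing \<open>1 = \<lambda>\<^sub>0 > \<gamma>\<^sub>1 > \<lambda>\<^sub>1 > \<dots> > \<gamma>\<^sub>r > \<lambda>\<^sub>r\<close>.\<close>

definition modified_geometric :: "real \<Rightarrow> real \<Rightarrow> nat pmf" where
  "modified_geometric g l =
     bind_pmf (bernoulli_pmf ((1 - g) / (1 - l)))
       (\<lambda>b. if b then return_pmf 0 else Geo (1 - g))"

end

theory Submission
  imports Defs
begin

text \<open>Expand the indicator of state \<open>0\<close> into eigenvectors of \<open>P\<close>, \<open>e\<^sub>0 = \<Sum>\<^sub>\<mu> u\<^sub>\<mu>\<close>. Orthogonality in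
  \<open>L\<^sup>2(\<pi>)\<close> makes the weights \<open>u\<^sub>\<mu>(0)\<close> positive, and the entry \<open>(0, 0)\<close> of the resolvent gives
  \<open>det(z - P\<^sub>0) / det(z - P) = \<Sum>\<^sub>\<mu> u\<^sub>\<mu>(0) / (z - \<mu>)\<close>. Hence the reduced eigenvalues of \<open>P\<close> and \<open>P\<^sub>0\<close> are
  the poles and zeros of this rational function, and they interlace. The generating function of
  the return probabilities \<open>P\<^sup>k(0, 0)\<close> is therefore \<open>\<Prod>\<^sub>i (1 - \<gamma>\<^sub>i z) / \<Prod>\<^sub>i (1 - \<lambda>\<^sub>i z)\<close>. By
  stationarity its product with the generating function of \<open>T\<^sub>0\<close> is \<open>\<pi>(0) / (1 - z)\<close>, so the latter
  is \<open>\<pi>(0) \<Prod>\<^sub>i (1 - \<lambda>\<^sub>i z) / (1 - \<gamma>\<^sub>i z)\<close> over \<open>i \<ge> 1\<close>. Up to constants, its factors are the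
  generating functions of the modified geometric laws. The constants agree because the eigenvector
  for the eigenvalue \<open>1\<close> is constant, which gives \<open>\<pi>(0) = u\<^sub>1(0) = \<Prod>\<^sub>i (1 - \<gamma>\<^sub>i) / (1 - \<lambda>\<^sub>i)\<close>; in
  particular \<open>T\<^sub>0\<close> is almost surely finite.\<close>

section \<open>Eigenvector expansions for reversible matrices\<close>

locale reversible_operator =
  fixes n :: nat and A :: "nat \<Rightarrow> nat \<Rightarrow> real" and w :: "nat \<Rightarrow> real"
  assumes weight_pos: "i \<le> n \<Longrightarrow> 0 < w i"
    and reversible: "i \<le> n \<Longrightarrow> j \<le> n \<Longrightarrow> w i * A i j = w j * A j i"
begin

text \<open>Complex vectors are used because the characteristic polynomial splits into linear
  factors over the complex numbers; that the eigenvalues needed are real is then derived from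
  self-adjointness.\<close>

definition T :: "(nat \<Rightarrow> complex) \<Rightarrow> nat \<Rightarrow> complex" where
  "T v i = (\<Sum>j\<le>n. of_real (A i j) * v j)"

definition ip :: "(nat \<Rightarrow> complex) \<Rightarrow> (nat \<Rightarrow> complex) \<Rightarrow> complex" where
  "ip x y = (\<Sum>i\<le>n. of_real (w i) * x i * cnj (y i))"

text \<open>\<open>T v\<close> reads \<open>v\<close> only at indices up to \<open>n\<close>, so
  agreement there already gives equality as functions. This lets identities known only in that range
  be used under \<open>T\<close>.\<close>

lemma T_cong: "(\<And>j. j \<le> n \<Longrightarrow> u j = v j) \<Longrightarrow> T u = T v"
  by (auto simp: T_def fun_eq_iff intro!: sum.cong)

lemma T_diff: "T (\<lambda>i. u i - v i) i = T u i - T v i"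
  by (simp add: T_def right_diff_distrib sum_subtractf)

lemma T_scale: "T (\<lambda>i. c * v i) i = c * T v i"
  by (simp add: T_def sum_distrib_left mult_ac)

lemma T_sum: "T (\<lambda>i. \<Sum>k\<in>K. u k i) i = (\<Sum>k\<in>K. T (u k) i)"
  unfolding T_def by (simp add: sum_distrib_left sum.swap[of _ _ K])

lemma ip_diff_left: "ip (\<lambda>i. u i - v i) y = ip u y - ip v y"
  by (simp add: ip_def algebra_simps sum_subtractf)

lemma ip_scale_left: "ip (\<lambda>i. c * v i) y = c * ip v y"
  by (simp add: ip_def sum_distrib_left mult_ac)

lemma ip_scale_right: "ip y (\<lambda>i. c * v i) = cnj c * ip y v"
  by (simp add: ip_def sum_distrib_left mult_ac)

lemma ip_cong:
  "(\<And>i. i \<le> n \<Longrightarrow> x i = x' i) \<Longrightarrow> (\<And>i. i \<le> n \<Longrightarrow> y i = y' i) \<Longrightarrow> ip x y = ip x' y'"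
  by (auto simp: ip_def intro!: sum.cong)

lemma ip_self_eq_0:
  assumes "ip x x = 0" "i \<le> n"
  shows "x i = 0"
proof -
  have "ip x x = of_real (\<Sum>i\<le>n. w i * (cmod (x i))\<^sup>2)"
    unfolding ip_def of_real_sum
    by (intro sum.cong refl) (simp add: complex_norm_square mult.assoc del: of_real_power)
  hence "(\<Sum>i\<le>n. w i * (cmod (x i))\<^sup>2) = 0"
    using assms(1) by (metis of_real_eq_0_iff)
  moreover have "0 \<le> w i * (cmod (x i))\<^sup>2" if "i \<le> n" for i
    using weight_pos[OF that] by simp
  ultimately have "\<forall>i\<in>{..n}. w i * (cmod (x i))\<^sup>2 = 0"
    by (subst (asm) sum_nonneg_eq_0_iff) auto
  from bspec[OF this, of i] show ?thesis using assms(2) weight_pos[OF assms(2)] by simp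
qed

text \<open>Detailed balance makes the kernel \<open>w i * A i j\<close> symmetric. As
  \<open>A\<close> is real, \<open>T\<close> is self-adjoint for the weighted inner product.\<close>

lemma ip_T: "ip (T x) y = ip x (T y)"
proof -
  have "ip (T x) y = (\<Sum>i\<le>n. \<Sum>j\<le>n. of_real (w i * A i j) * x j * cnj (y i))"
    by (simp add: ip_def T_def sum_distrib_left sum_distrib_right mult_ac)
  also have "\<dots> = (\<Sum>i\<le>n. \<Sum>j\<le>n. of_real (w j * A j i) * x j * cnj (y i))"
    by (intro sum.cong refl, subst reversible) auto
  also have "\<dots> = (\<Sum>j\<le>n. \<Sum>i\<le>n. of_real (w j * A j i) * x j * cnj (y i))"
    by (rule sum.swap)
  also have "\<dots> = ip x (T y)"
    by (simp add: ip_def T_def sum_distrib_left mult_ac)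
  finally show ?thesis .
qed

text \<open>The recursion changes the vector rather than the result, so the induction hypothesis
  below applies to \<open>T v - a v\<close>.\<close>

fun shifts :: "complex list \<Rightarrow> (nat \<Rightarrow> complex) \<Rightarrow> nat \<Rightarrow> complex" where
  "shifts [] v = v"
| "shifts (a # as) v = shifts as (\<lambda>i. T v i - a * v i)"

text \<open>Peel off one factor \<open>T - a\<close> at a time: dividing the components for \<open>\<mu> \<noteq> a\<close> by \<open>\<mu> - a\<close>
  leaves a vector \<open>x\<close> for which \<open>T x - a x\<close> lies in the kernel of \<open>T - a\<close>. By self-adjointness
  it is also orthogonal to this kernel if \<open>a\<close> is real, and \<open>x\<close> itself vanishes otherwise.\<close>

lemma sum_of_eigenvectors_if_shifts_eq_0:
  assumes "\<And>i. i \<le> n \<Longrightarrow> shifts as v i = 0"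
  shows "\<exists>(L :: real set) u. finite L \<and> (\<forall>\<mu>\<in>L. \<forall>i\<le>n. T (u \<mu>) i = of_real \<mu> * u \<mu> i) \<and>
    (\<forall>i\<le>n. v i = (\<Sum>\<mu>\<in>L. u \<mu> i))"
  using assms
proof (induction as arbitrary: v)
  case Nil
  thus ?case by (intro exI[of _ "{}"] exI) auto
next
  case (Cons a as)
  from Cons.IH[of "\<lambda>i. T v i - a * v i"] Cons.prems
  obtain L :: "real set" and u where fin: "finite L"
    and eig: "\<And>\<mu> i. \<mu> \<in> L \<Longrightarrow> i \<le> n \<Longrightarrow> T (u \<mu>) i = of_real \<mu> * u \<mu> i"
    and sum: "\<And>i. i \<le> n \<Longrightarrow> T v i - a * v i = (\<Sum>\<mu>\<in>L. u \<mu> i)"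
    by fastforce
  \<comment> \<open>The component for \<open>a\<close> cannot be divided by
    \<open>\<mu> - a\<close>; it is set to zero here and collected in \<open>e\<close>.\<close>
  define u' where "u' \<mu> = (\<lambda>i. (if of_real \<mu> = a then 0 else 1 / (of_real \<mu> - a)) * u \<mu> i)" for \<mu> :: real
  define x where "x = (\<lambda>i. v i - (\<Sum>\<mu>\<in>L. u' \<mu> i))"
  define e where "e = (\<lambda>i. (\<Sum>\<mu>\<in>{\<mu>\<in>L. of_real \<mu> = a}. u \<mu> i))"
  have T_u': "T (u' \<mu>) i = of_real \<mu> * u' \<mu> i" if "\<mu> \<in> L" "i \<le> n" for \<mu> i
    using eig[OF that] by (simp add: u'_def T_scale)
  have Te: "T e i = a * e i" if "i \<le> n" for i
    unfolding e_def T_sum sum_distrib_left using eig that by (auto intro!: sum.cong)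
  have Tx: "T x i - a * x i = e i" if "i \<le> n" for i
  proof -
    have "T x i - a * x i = (T v i - a * v i) - (\<Sum>\<mu>\<in>L. T (u' \<mu>) i - a * u' \<mu> i)"
      unfolding x_def T_diff T_sum by (simp add: algebra_simps sum_subtractf sum_distrib_left)
    also have "\<dots> = (\<Sum>\<mu>\<in>L. u \<mu> i - (of_real \<mu> - a) * u' \<mu> i)"
      by (simp add: sum[OF that] T_u' that sum_subtractf[symmetric] left_diff_distrib)
    also have "\<dots> = (\<Sum>\<mu>\<in>L. if of_real \<mu> = a then u \<mu> i else 0)"
      by (intro sum.cong refl) (auto simp: u'_def)
    also have "\<dots> = e i"
      unfolding e_def using fin by (intro sum.inter_filter[symmetric])
    finally show ?thesis .
  qed
  have e0: "e i = 0" if "i \<le> n" for i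
  proof (cases "\<exists>\<mu>\<in>L. of_real \<mu> = a")
    case True
    then obtain \<alpha> where \<alpha>: "a = of_real \<alpha>" by auto
    have "ip e e = ip (\<lambda>i. T x i - a * x i) e" by (rule ip_cong) (simp_all add: Tx)
    also have "\<dots> = ip x (T e) - a * ip x e" by (simp add: ip_diff_left ip_scale_left ip_T)
    also have "ip x (T e) = ip x (\<lambda>i. a * e i)" by (rule ip_cong) (simp_all add: Te)
    finally have "ip e e = 0" by (simp add: ip_scale_right \<alpha>)
    thus ?thesis using ip_self_eq_0 that by blast
  next
    case False
    thus ?thesis by (auto simp: e_def intro!: sum.neutral)
  qed
  have Tx': "T x i = a * x i" if "i \<le> n" for i using Tx[OF that] e0[OF that] by simp
  have v: "v i = x i + (\<Sum>\<mu>\<in>L. u' \<mu> i)" for i by (simp add: x_def)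
  show ?case
  proof (cases "a \<in> \<real>")
    case True
    then obtain \<alpha> where \<alpha>: "a = of_real \<alpha>" by (auto elim: Reals_cases)
    \<comment> \<open>\<open>u' \<alpha>\<close> vanishes by construction, so overwriting it with
      \<open>x\<close> loses nothing even if \<open>\<alpha>\<close> already lies in
      \<open>L\<close>.\<close>
    have "(\<Sum>\<mu>\<in>insert \<alpha> L. ((\<lambda>\<mu>. u' \<mu>)(\<alpha> := x)) \<mu> i) = x i + (\<Sum>\<mu>\<in>L. u' \<mu> i)" for i
    proof -
      have "(\<Sum>\<mu>\<in>insert \<alpha> L. ((\<lambda>\<mu>. u' \<mu>)(\<alpha> := x)) \<mu> i) = x i + (\<Sum>\<mu>\<in>L - {\<alpha>}. u' \<mu> i)"
        using fin by (subst sum.insert_remove) (auto intro!: sum.cong)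
      also have "(\<Sum>\<mu>\<in>L - {\<alpha>}. u' \<mu> i) = (\<Sum>\<mu>\<in>L. u' \<mu> i)"
        using fin by (intro sum.mono_neutral_left) (auto simp: u'_def \<alpha>)
      finally show ?thesis .
    qed
    thus ?thesis using fin T_u' Tx' v \<alpha>
      by (intro exI[of _ "insert \<alpha> L"] exI[of _ "(\<lambda>\<mu>. u' \<mu>)(\<alpha> := x)"]) auto
  next
    case False
    have "a * ip x x = ip (\<lambda>i. a * x i) x" by (simp add: ip_scale_left)
    also have "\<dots> = ip (T x) x" by (rule ip_cong) (simp_all add: Tx')
    also have "\<dots> = ip x (\<lambda>i. a * x i)" unfolding ip_T by (rule ip_cong) (simp_all add: Tx')
    finally have "a * ip x x = cnj a * ip x x" by (simp add: ip_scale_right)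
    hence "ip x x = 0" using False by (auto simp: Reals_cnj_iff)
    hence "x i = 0" if "i \<le> n" for i using ip_self_eq_0 that by blast
    thus ?thesis using fin T_u' v
      by (intro exI[of _ L] exI[of _ u']) auto
  qed
qed

section \<open>Polynomials in the operator and Cayley-Hamilton\<close>

definition poly_op :: "complex poly \<Rightarrow> (nat \<Rightarrow> complex) \<Rightarrow> nat \<Rightarrow> complex" where
  "poly_op f v i = (\<Sum>k\<le>degree f. coeff f k * (T ^^ k) v i)"

lemma poly_op_altdef:
  assumes "degree f < N"
  shows "poly_op f v i = (\<Sum>k<N. coeff f k * (T ^^ k) v i)"
  unfolding poly_op_def using assms
  by (intro sum.mono_neutral_left) (auto simp: coeff_eq_0)

lemma T_power_diff_scale:
  "(T ^^ k) (\<lambda>i. u i - c * v i) i = (T ^^ k) u i - c * (T ^^ k) v i"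
proof (induction k arbitrary: i)
  case (Suc k)
  have "(T ^^ Suc k) (\<lambda>i. u i - c * v i) i = T (\<lambda>i. (T ^^ k) u i - c * (T ^^ k) v i) i"
    by (simp add: Suc.IH[abs_def])
  thus ?case by (simp add: T_diff T_scale)
qed auto

text \<open>Multiplication by the variable shifts the coefficients by one; applying the additional
  power of \<open>T\<close> to \<open>v\<close> first reproduces the recursion of
  \<open>shifts\<close>.\<close>

lemma poly_op_linear_factor_mult:
  "poly_op ([:-a, 1:] * f) v i = poly_op f (\<lambda>i. T v i - a * v i) i"
proof -
  define N where "N = Suc (degree f)"
  have "degree ([:-a, 1:] * f) < Suc N"
    by (rule le_less_trans[OF degree_mult_le]) (simp add: N_def)
  hence "poly_op ([:-a, 1:] * f) v i =
      (\<Sum>k<Suc N. coeff (pCons 0 f) k * (T ^^ k) v i) - a * (\<Sum>k<Suc N. coeff f k * (T ^^ k) v i)"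
    by (simp add: poly_op_altdef sum_distrib_left sum_subtractf algebra_simps del: sum.lessThan_Suc)
  also have "(\<Sum>k<Suc N. coeff (pCons 0 f) k * (T ^^ k) v i) = (\<Sum>k<N. coeff f k * (T ^^ k) (T v) i)"
    by (subst sum.lessThan_Suc_shift) (simp add: funpow_swap1)
  also have "(\<Sum>k<Suc N. coeff f k * (T ^^ k) v i) = (\<Sum>k<N. coeff f k * (T ^^ k) v i)"
    by (simp add: N_def coeff_eq_0)
  also have "(\<Sum>k<N. coeff f k * (T ^^ k) (T v) i) - a * (\<Sum>k<N. coeff f k * (T ^^ k) v i) =
      (\<Sum>k<N. coeff f k * (T ^^ k) (\<lambda>i. T v i - a * v i) i)"
    by (simp add: T_power_diff_scale sum_distrib_left sum_subtractf algebra_simps)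
  finally show ?thesis by (simp add: poly_op_altdef[of f N] N_def)
qed

lemma shifts_eq_poly_op: "shifts as v i = poly_op (\<Prod>a\<leftarrow>as. [:-a, 1:]) v i"
proof (induction as arbitrary: v)
  case Nil
  show ?case by (simp add: poly_op_def)
next
  case (Cons a as)
  show ?case unfolding list.map prod_list.Cons poly_op_linear_factor_mult shifts.simps Cons.IH ..
qed

text \<open>Cayley--Hamilton for a single vector: comparing coefficients in \<open>(x - T) b = p e\<close> makes the
  partial sums of \<open>p(T) e\<close> telescope.\<close>

lemma poly_op_eq_0:
  assumes "\<And>i. i \<le> n \<Longrightarrow>
    [:0, 1:] * b i - (\<Sum>j\<le>n. [:of_real (A i j):] * b j) = Polynomial.smult (e i) p"
    and "i \<le> n"
  shows "poly_op p e i = 0"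
proof -
  \<comment> \<open>Coefficient \<open>k\<close> of the hypothesis;
    \<open>coeff (pCons 0 (b i)) k\<close> is coefficient \<open>k - 1\<close> of
    \<open>b i\<close>, and zero for \<open>k = 0\<close>.\<close>
  have co: "e i * coeff p k = coeff (pCons 0 (b i)) k - T (\<lambda>j. coeff (b j) k) i" if "i \<le> n" for i k
    using assms(1)[OF that] by (auto simp: poly_eq_iff T_def coeff_sum algebra_simps)
  have tele: "(\<Sum>k<N. coeff p k * (T ^^ k) e i) = - (T ^^ N) (\<lambda>j. coeff (pCons 0 (b j)) N) i"
    if "i \<le> n" for N i
  proof (induction N)
    case (Suc N)
    \<comment> \<open>The identity \<open>co\<close> is available only at indices up to
      \<open>n\<close>. For positive \<open>N\<close> one application of \<open>T\<close> ignores
      all others; for \<open>N = 0\<close> only the index \<open>i\<close> itself matters.\<close>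
    have step: "(T ^^ N) (\<lambda>i. coeff (pCons 0 (b i)) N - T (\<lambda>j. coeff (b j) N) i) i =
        coeff p N * (T ^^ N) e i"
    proof (cases N)
      case (Suc M)
      have T': "T (\<lambda>i. coeff (pCons 0 (b i)) N - T (\<lambda>j. coeff (b j) N) i) = T (\<lambda>i. coeff p N * e i)"
        by (rule T_cong) (simp add: co[symmetric])
      \<comment> \<open>The second instance shows that \<open>T ^^ M\<close> maps zero to zero; the
        first then gives homogeneity.\<close>
      have scale: "(T ^^ M) (\<lambda>i. c * v i) i = c * (T ^^ M) v i" for c v i
        using T_power_diff_scale[of M "\<lambda>_. 0" "-c" v i] T_power_diff_scale[of M "\<lambda>_. 0" "1" "\<lambda>_. 0" i]
        by simp
      show ?thesis using T' by (simp add: Suc funpow_swap1 T_scale[abs_def] scale del: T_scale)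
    next
      case 0
      thus ?thesis using co[OF that, of 0] by (simp add: mult.commute)
    qed
    have "(\<Sum>k<Suc N. coeff p k * (T ^^ k) e i) = 
      - (T ^^ N) (\<lambda>j. coeff (pCons 0 (b j)) N) i +
       (T ^^ N) (\<lambda>i. coeff (pCons 0 (b i)) N - T (\<lambda>j. coeff (b j) N) i) i"
      using Suc step by simp
    also have "\<dots> = - (T ^^ N) (T (\<lambda>j. coeff (b j) N)) i"
      using T_power_diff_scale[of N "\<lambda>i. coeff (pCons 0 (b i)) N" 1] by simp
    finally show ?case by (simp add: funpow_swap1)
  qed auto
  \<comment> \<open>Beyond the degrees of \<open>p\<close> and of all \<open>pCons 0 (b j)\<close>,
    the sum in \<open>tele\<close> is complete and its remainder vanishes.\<close>
  define N where "N = Suc (Max (insert (degree p) ((\<lambda>j. Suc (degree (b j))) ` {..n})))"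
  have "degree p < N" unfolding N_def less_Suc_eq_le by (intro Max_ge) auto
  moreover have "degree (pCons 0 (b j)) < N" if "j \<le> n" for j
  proof -
    have "Suc (degree (b j)) < N" unfolding N_def less_Suc_eq_le using that by (intro Max_ge) auto
    thus ?thesis by (intro le_less_trans[OF degree_pCons_le])
  qed
  hence "coeff (pCons 0 (b j)) N = 0" if "j \<le> n" for j using that by (simp add: coeff_eq_0)
  hence "T (\<lambda>j. coeff (pCons 0 (b j)) N) = T (\<lambda>_. 0)" by (intro T_cong) auto
  moreover have "(T ^^ k) (\<lambda>_. 0) = (\<lambda>_. 0)" for k
    by (induction k) (auto simp: T_def)
  moreover have "T (\<lambda>_. 0) = (\<lambda>_. 0)" by (simp add: T_def fun_eq_iff)
  moreover obtain M where "N = Suc M" by (simp add: N_def)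
  ultimately have "(T ^^ N) (\<lambda>j. coeff (pCons 0 (b j)) N) i = 0"
    by (simp add: funpow_swap1)
  thus ?thesis using tele[OF assms(2)] \<open>degree p < N\<close> by (simp add: poly_op_altdef)
qed

end

section \<open>Characteristic polynomials and the adjugate\<close>

lemma char_poly_matrix_index:
  assumes "A \<in> carrier_mat m m" "i < m" "j < m"
  shows "char_poly_matrix A $$ (i, j) = (if i = j then [:0, 1:] else 0) - [:A $$ (i, j):]"
  using assms by (auto simp: char_poly_matrix_def)

lemma mat_delete_char_poly_matrix:
  assumes "A \<in> carrier_mat (Suc n) (Suc n)"
  shows "mat_delete (char_poly_matrix A) 0 0 = char_poly_matrix (mat_delete A 0 0)"
  using assms by (intro eq_matI) (auto simp: mat_delete_def char_poly_matrix_def)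

text \<open>Take column 0 of the adjugate of the characteristic matrix. The matrix times its
  adjugate is the determinant times the identity, and the entry at (0, 0) is the cofactor left after
  deleting row 0 and column 0.\<close>

lemma char_poly_resolvent_column:
  fixes A :: "'a :: comm_ring_1 mat"
  assumes A: "A \<in> carrier_mat (Suc n) (Suc n)"
  obtains b where "b 0 = char_poly (mat_delete A 0 0)"
    and "\<And>i. i \<le> n \<Longrightarrow> [:0, 1:] * b i - (\<Sum>j\<le>n. [:A $$ (i, j):] * b j) =
           (if i = 0 then char_poly A else 0)"
proof -
  define X where "X = char_poly_matrix A"
  define b where "b j = adj_mat X $$ (j, 0)" for j
  have X: "X \<in> carrier_mat (Suc n) (Suc n)" using A by (simp add: X_def)
  have b0: "b 0 = char_poly (mat_delete A 0 0)"
    using X mat_delete_char_poly_matrix[OF A]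
    by (simp add: b_def adj_mat_def cofactor_def char_poly_def X_def)
  have "[:0, 1:] * b i - (\<Sum>j\<le>n. [:A $$ (i, j):] * b j) = (if i = 0 then char_poly A else 0)"
    if i: "i \<le> n" for i
  proof -
    have "[:0, 1:] * b i - (\<Sum>j\<le>n. [:A $$ (i, j):] * b j) =
        (\<Sum>j\<le>n. ((if i = j then [:0, 1:] else 0) - [:A $$ (i, j):]) * b j)"
      using i by (simp add: left_diff_distrib sum_subtractf if_distrib[of "\<lambda>x. x * _"] cong: if_cong)
    also have "\<dots> = (\<Sum>j\<in>{0..<Suc n}. X $$ (i, j) * adj_mat X $$ (j, 0))"
      using i A by (intro sum.cong) (auto simp: X_def char_poly_matrix_index b_def)
    also have "\<dots> = (X * adj_mat X) $$ (i, 0)"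
      using X adj_mat(1)[OF X] i by (simp add: scalar_prod_def del: sum.op_ivl_Suc)
    also have "\<dots> = (if i = 0 then char_poly A else 0)"
      using adj_mat(2)[OF X] i by (simp add: char_poly_def X_def)
    finally show ?thesis .
  qed
  with b0 show thesis by (rule that)
qed

section \<open>Expansion of the unit vector at 0 into real eigenvectors\<close>

context reversible_operator
begin

text \<open>The adjugate column provides the \<open>b\<close> of \<open>poly_op_eq_0\<close> for the
  characteristic polynomial, whose linear factors form the list for \<open>shifts\<close>. Some of
  the resulting vectors may be zero.\<close>

lemma complex_eigenvector_expansion:
  obtains L :: "real set" and u where "finite L"
    and "\<And>\<mu> i. \<mu> \<in> L \<Longrightarrow> i \<le> n \<Longrightarrow> T (u \<mu>) i = of_real \<mu> * u \<mu> i"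
    and "\<And>i. i \<le> n \<Longrightarrow> (\<Sum>\<mu>\<in>L. u \<mu> i) = (if i = 0 then 1 else 0)"
proof -
  define C where "C = mat (Suc n) (Suc n) (\<lambda>(i, j). complex_of_real (A i j))"
  define e :: "nat \<Rightarrow> complex" where "e i = (if i = 0 then 1 else 0)" for i
  have C: "C \<in> carrier_mat (Suc n) (Suc n)" by (simp add: C_def)
  obtain b where b: "\<And>i. i \<le> n \<Longrightarrow> [:0, 1:] * b i - (\<Sum>j\<le>n. [:C $$ (i, j):] * b j) =
      (if i = 0 then char_poly C else 0)"
    using char_poly_resolvent_column[OF C] by blast
  obtain as where as: "char_poly C = (\<Prod>a\<leftarrow>as. [:-a, 1:])"
    using char_poly_factorized[OF C] by auto
  have "shifts as e i = 0" if "i \<le> n" for i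
    unfolding shifts_eq_poly_op as[symmetric]
  proof (rule poly_op_eq_0[OF _ that])
    fix i assume i: "i \<le> n"
    have "(\<Sum>j\<le>n. [:of_real (A i j):] * b j) = (\<Sum>j\<le>n. [:C $$ (i, j):] * b j)"
      using i by (intro sum.cong) (auto simp: C_def)
    thus "[:0, 1:] * b i - (\<Sum>j\<le>n. [:of_real (A i j):] * b j) = Polynomial.smult (e i) (char_poly C)"
      using b[OF i] by (simp add: e_def)
  qed
  from sum_of_eigenvectors_if_shifts_eq_0[of as e, OF this]
  obtain L :: "real set" and u where "finite L \<and>
      (\<forall>\<mu>\<in>L. \<forall>i\<le>n. T (u \<mu>) i = of_real \<mu> * u \<mu> i) \<and> (\<forall>i\<le>n. e i = (\<Sum>\<mu>\<in>L. u \<mu> i))"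
    by blast
  with that[of L u] show thesis by (simp add: e_def)
qed

lemma eigenvector_expansion:
  obtains L :: "real set" and u where "finite L"
    and "\<And>\<mu> i. \<mu> \<in> L \<Longrightarrow> i \<le> n \<Longrightarrow> (\<Sum>j\<le>n. A i j * u \<mu> j) = \<mu> * u \<mu> i"
    and "\<And>i. i \<le> n \<Longrightarrow> (\<Sum>\<mu>\<in>L. u \<mu> i) = (if i = 0 then 1 else 0)"
    and "\<And>\<mu>. \<mu> \<in> L \<Longrightarrow> 0 < u \<mu> (0 :: nat)"
proof -
  obtain L :: "real set" and v where fin: "finite L"
    and v: "\<And>\<mu> i. \<mu> \<in> L \<Longrightarrow> i \<le> n \<Longrightarrow> T (v \<mu>) i = of_real \<mu> * v \<mu> i"
    and sum_v: "\<And>i. i \<le> n \<Longrightarrow> (\<Sum>\<mu>\<in>L. v \<mu> i) = (if i = 0 then 1 else 0)"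
    by (rule complex_eigenvector_expansion) blast
  define u where "u \<mu> i = Re (v \<mu> i)" for \<mu> i
  define q where "q x y = (\<Sum>i\<le>n. w i * x i * y i)" for x y :: "nat \<Rightarrow> real"
  have u: "(\<Sum>j\<le>n. A i j * u \<mu> j) = \<mu> * u \<mu> i" if "\<mu> \<in> L" "i \<le> n" for \<mu> i
    using arg_cong[OF v[OF that], of Re] by (simp add: u_def T_def)
  have sum_u: "(\<Sum>\<mu>\<in>L. u \<mu> i) = (if i = 0 then 1 else 0)" if "i \<le> n" for i
    using arg_cong[OF sum_v[OF that], of Re] by (simp add: u_def)
  have orth: "q (u \<mu>) (u \<nu>) = 0" if "\<mu> \<in> L" "\<nu> \<in> L" "\<mu> \<noteq> \<nu>" for \<mu> \<nu>
  proof -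
    have "\<mu> * q (u \<mu>) (u \<nu>) = (\<Sum>i\<le>n. w i * (\<mu> * u \<mu> i) * u \<nu> i)"
      by (simp add: q_def sum_distrib_left mult_ac)
    also have "\<dots> = (\<Sum>i\<le>n. \<Sum>j\<le>n. (w i * A i j) * u \<mu> j * u \<nu> i)"
      by (intro sum.cong refl) (simp add: u[symmetric] that sum_distrib_left sum_distrib_right mult_ac)
    also have "\<dots> = (\<Sum>j\<le>n. \<Sum>i\<le>n. (w j * A j i) * u \<mu> j * u \<nu> i)"
      by (subst sum.swap, intro sum.cong refl, subst reversible) auto
    also have "\<dots> = (\<Sum>i\<le>n. w i * u \<mu> i * (\<nu> * u \<nu> i))"
      by (intro sum.cong refl) (simp add: u[symmetric] that sum_distrib_left sum_distrib_right mult_ac)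
    also have "\<dots> = \<nu> * q (u \<mu>) (u \<nu>)"
      by (simp add: q_def sum_distrib_left mult_ac)
    finally show ?thesis using that by simp
  qed
  have q_self: "q (u \<mu>) (u \<mu>) = w 0 * u \<mu> 0" if "\<mu> \<in> L" for \<mu>
  proof -
    have "w 0 * u \<mu> 0 = (\<Sum>i\<le>n. w i * u \<mu> i * (if i = 0 then 1 else 0))"
      by (simp add: if_distrib cong: if_cong)
    also have "\<dots> = (\<Sum>i\<le>n. w i * u \<mu> i * (\<Sum>\<nu>\<in>L. u \<nu> i))"
      by (intro sum.cong refl) (simp add: sum_u)
    also have "\<dots> = (\<Sum>\<nu>\<in>L. q (u \<mu>) (u \<nu>))"
      unfolding q_def by (simp add: sum_distrib_left sum.swap[of _ _ L])
    also have "\<dots> = (\<Sum>\<nu>\<in>{\<mu>}. q (u \<mu>) (u \<nu>))"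
      using fin that orth by (intro sum.mono_neutral_right) auto
    finally show ?thesis by simp
  qed
  have pos: "0 \<le> w i * u \<mu> i * u \<mu> i" if "i \<le> n" for i \<mu>
    using weight_pos[OF that] by (simp add: mult.assoc)
  have nonneg: "0 \<le> u \<mu> 0" if "\<mu> \<in> L" for \<mu>
  proof -
    have "0 \<le> q (u \<mu>) (u \<mu>)" unfolding q_def using pos by (intro sum_nonneg) auto
    thus ?thesis using q_self[OF that] weight_pos[of 0] by (simp add: zero_le_mult_iff)
  qed
  have zero: "u \<mu> i = 0" if "\<mu> \<in> L" "u \<mu> 0 = 0" "i \<le> n" for \<mu> i
  proof -
    have "q (u \<mu>) (u \<mu>) = 0" using q_self that by simp
    hence "\<forall>i\<in>{..n}. w i * u \<mu> i * u \<mu> i = 0"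
      unfolding q_def using pos by (subst (asm) sum_nonneg_eq_0_iff) auto
    from bspec[OF this, of i] show ?thesis using that weight_pos[of i] by simp
  qed
  show thesis
  proof (rule that[of "{\<mu>\<in>L. u \<mu> 0 \<noteq> 0}" u])
    fix i assume "i \<le> n"
    have "(\<Sum>\<mu>\<in>{\<mu> \<in> L. u \<mu> 0 \<noteq> 0}. u \<mu> i) = (\<Sum>\<mu>\<in>L. u \<mu> i)"
      using fin zero \<open>i \<le> n\<close> by (intro sum.mono_neutral_left) auto
    thus "(\<Sum>\<mu>\<in>{\<mu> \<in> L. u \<mu> 0 \<noteq> 0}. u \<mu> i) = (if i = 0 then 1 else 0)"
      using sum_u[OF \<open>i \<le> n\<close>] by simp
  next
    fix \<mu> assume "\<mu> \<in> {\<mu> \<in> L. u \<mu> 0 \<noteq> 0}"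
    thus "0 < u \<mu> 0" using nonneg[of \<mu>] by auto
  qed (use fin u in auto)
qed

text \<open>The vector \<open>\<Sum>\<^sub>\<mu> u\<^sub>\<mu> / (z - \<mu>)\<close> is column \<open>0\<close> of the resolvent \<open>(z - P)\<^sup>-\<^sup>1\<close>.\<close>

lemma char_poly_delete_eq:
  assumes P: "P \<in> carrier_mat (Suc n) (Suc n)"
    and P_A: "\<And>i j. i \<le> n \<Longrightarrow> j \<le> n \<Longrightarrow> P $$ (i, j) = A i j"
    and eig: "\<And>\<mu> i. \<mu> \<in> L \<Longrightarrow> i \<le> n \<Longrightarrow> (\<Sum>j\<le>n. A i j * u \<mu> j) = \<mu> * u \<mu> i"
    and sum_u: "\<And>i. i \<le> n \<Longrightarrow> (\<Sum>\<mu>\<in>L. u \<mu> i) = (if i = 0 then 1 else 0)"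
    and z: "z \<notin> L"
  shows "poly (char_poly (mat_delete P 0 0)) z = poly (char_poly P) z * (\<Sum>\<mu>\<in>L. u \<mu> 0 / (z - \<mu>))"
proof -
  obtain b where b0: "b 0 = char_poly (mat_delete P 0 0)"
    and b: "\<And>i. i \<le> n \<Longrightarrow> [:0, 1:] * b i - (\<Sum>j\<le>n. [:P $$ (i, j):] * b j) =
      (if i = 0 then char_poly P else 0)"
    using char_poly_resolvent_column[OF P] by blast
  define \<beta> where "\<beta> i = poly (b i) z" for i
  define v where "v i = (\<Sum>\<mu>\<in>L. u \<mu> i / (z - \<mu>))" for i
  have \<beta>: "z * \<beta> i - (\<Sum>j\<le>n. A i j * \<beta> j) = (if i = 0 then poly (char_poly P) z else 0)" if "i \<le> n" for i
  proof -
    have "(\<Sum>j\<le>n. P $$ (i, j) * \<beta> j) = (\<Sum>j\<le>n. A i j * \<beta> j)"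
      using that by (intro sum.cong) (auto simp: P_A)
    thus ?thesis using arg_cong[OF b[OF that], of "\<lambda>p. poly p z"] by (auto simp: \<beta>_def poly_sum)
  qed
  have v: "z * v j - (\<Sum>i\<le>n. A j i * v i) = (if j = 0 then 1 else 0)" if "j \<le> n" for j
  proof -
    have "(\<Sum>i\<le>n. A j i * v i) = (\<Sum>\<mu>\<in>L. (\<Sum>i\<le>n. A j i * u \<mu> i) / (z - \<mu>))"
      by (simp add: v_def sum_distrib_left sum_divide_distrib sum.swap[of _ _ L])
    also have "\<dots> = (\<Sum>\<mu>\<in>L. \<mu> * u \<mu> j / (z - \<mu>))"
      by (intro sum.cong refl) (simp add: eig that)
    finally have "z * v j - (\<Sum>i\<le>n. A j i * v i) = (\<Sum>\<mu>\<in>L. z * (u \<mu> j / (z - \<mu>)) - \<mu> * u \<mu> j / (z - \<mu>))"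
      by (simp add: v_def sum_distrib_left sum_subtractf)
    also have "\<dots> = (\<Sum>\<mu>\<in>L. u \<mu> j)"
    proof (intro sum.cong refl)
      fix \<mu> assume "\<mu> \<in> L"
      hence "z - \<mu> \<noteq> 0" using z by auto
      moreover have "z * (u \<mu> j / (z - \<mu>)) - \<mu> * u \<mu> j / (z - \<mu>) = (z - \<mu>) * u \<mu> j / (z - \<mu>)"
        by (simp add: diff_divide_distrib left_diff_distrib)
      ultimately show "z * (u \<mu> j / (z - \<mu>)) - \<mu> * u \<mu> j / (z - \<mu>) = u \<mu> j" by simp
    qed
    finally show ?thesis using sum_u[OF that] by simp
  qed
  \<comment> \<open>Pair \<open>(z - A) \<beta>\<close> with \<open>v\<close> in the weighted form
    and move \<open>z - A\<close> to \<open>v\<close> by symmetry of the kernel. No inverse of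
    \<open>z - A\<close> is used, so \<open>z\<close> may be an eigenvalue outside
    \<open>L\<close>.\<close>
  have "w 0 * (poly (char_poly P) z * v 0) =
      (\<Sum>i\<le>n. w i * v i * (if i = 0 then poly (char_poly P) z else 0))"
    by (simp add: if_distrib cong: if_cong)
  also have "\<dots> = (\<Sum>i\<le>n. w i * v i * (z * \<beta> i)) - (\<Sum>i\<le>n. \<Sum>j\<le>n. (w i * A i j) * v i * \<beta> j)"
    by (subst sum_subtractf[symmetric], intro sum.cong refl)
      (simp add: \<beta>[symmetric] right_diff_distrib sum_distrib_left mult_ac)
  also have "(\<Sum>i\<le>n. \<Sum>j\<le>n. (w i * A i j) * v i * \<beta> j) = (\<Sum>j\<le>n. \<Sum>i\<le>n. (w j * A j i) * v i * \<beta> j)"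
    by (subst sum.swap, intro sum.cong refl, subst reversible) auto
  also have "(\<Sum>i\<le>n. w i * v i * (z * \<beta> i)) - \<dots> = (\<Sum>j\<le>n. w j * \<beta> j * (if j = 0 then 1 else 0))"
    by (subst sum_subtractf[symmetric], intro sum.cong refl)
      (simp add: v[symmetric] right_diff_distrib sum_distrib_left mult_ac)
  also have "\<dots> = w 0 * \<beta> 0"
    by (simp add: if_distrib cong: if_cong)
  finally show ?thesis using weight_pos[of 0] by (simp add: v_def \<beta>_def b0)
qed

end

section \<open>Rational functions with positive residues\<close>

text \<open>The function in question is the sum of the \<open>W \<mu> / (z - \<mu>)\<close>, written
  below as \<open>numer / denom\<close>. Positive weights exclude cancellation; total weight one
  makes \<open>numer\<close> monic of degree \<open>card L - 1\<close>.\<close>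

locale positive_partial_fraction =
  fixes L :: "real set" and W :: "real \<Rightarrow> real"
  assumes finite_poles: "finite L"
    and weight_gt_0: "\<mu> \<in> L \<Longrightarrow> 0 < W \<mu>"
    and sum_weights: "(\<Sum>\<mu>\<in>L. W \<mu>) = 1"
begin

definition denom :: "real poly" where
  "denom = (\<Prod>\<mu>\<in>L. [:-\<mu>, 1:])"

definition numer :: "real poly" where
  "numer = (\<Sum>\<mu>\<in>L. Polynomial.smult (W \<mu>) (\<Prod>\<nu>\<in>L - {\<mu>}. [:-\<nu>, 1:]))"

lemma poly_numer: "poly numer z = (\<Sum>\<mu>\<in>L. W \<mu> * (\<Prod>\<nu>\<in>L - {\<mu>}. z - \<nu>))"
  by (simp add: numer_def poly_sum poly_prod)

text \<open>Every other summand of \<open>numer\<close> contains the factor that vanishes at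
  \<open>\<kappa>\<close>.\<close>

lemma poly_numer_pole:
  assumes "\<kappa> \<in> L"
  shows "poly numer \<kappa> = W \<kappa> * (\<Prod>\<nu>\<in>L - {\<kappa>}. \<kappa> - \<nu>)"
proof -
  have "poly numer \<kappa> = (\<Sum>\<mu>\<in>{\<kappa>}. W \<mu> * (\<Prod>\<nu>\<in>L - {\<mu>}. \<kappa> - \<nu>))"
    unfolding poly_numer using assms finite_poles
    by (intro sum.mono_neutral_right ballI) (auto intro!: prod_zero)
  thus ?thesis by simp
qed

lemma poly_numer_eq:
  assumes "z \<notin> L"
  shows "poly numer z = poly denom z * (\<Sum>\<mu>\<in>L. W \<mu> / (z - \<mu>))"
proof -
  have "W \<mu> * (\<Prod>\<nu>\<in>L - {\<mu>}. z - \<nu>) = poly denom z * (W \<mu> / (z - \<mu>))" if "\<mu> \<in> L" for \<mu>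
  proof -
    have "z - \<mu> \<noteq> 0" using assms that by auto
    moreover have "poly denom z = (z - \<mu>) * (\<Prod>\<nu>\<in>L - {\<mu>}. z - \<nu>)"
      using finite_poles that by (simp add: denom_def poly_prod prod.remove left_diff_distrib)
    ultimately show ?thesis by simp
  qed
  thus ?thesis by (simp add: poly_numer sum_distrib_left)
qed

lemma denom_neq_0: "denom \<noteq> 0"
  using finite_poles by (auto simp: denom_def)

lemma proots_denom: "proots denom = mset_set L"
proof -
  have "proots denom = (\<Sum>\<mu>\<in>L. {#\<mu>#})"
    unfolding denom_def by (subst proots_prod) auto
  thus ?thesis by simp
qed

lemma degree_pole_product:
  "\<mu> \<in> L \<Longrightarrow> degree (\<Prod>\<nu>\<in>L - {\<mu>}. [:-\<nu>, 1:]) = card L - 1"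
  using finite_poles by (subst degree_prod_sum_eq) auto

lemma degree_numer_le: "degree numer \<le> card L - 1"
  unfolding numer_def
  by (intro degree_sum_le[OF finite_poles] order.trans[OF degree_smult_le]) (simp add: degree_pole_product)

lemma coeff_numer: "coeff numer (card L - 1) = 1"
proof -
  have "coeff (\<Prod>\<nu>\<in>L - {\<mu>}. [:-\<nu>, 1:]) (card L - 1) = 1" if "\<mu> \<in> L" for \<mu>
  proof -
    have "coeff (\<Prod>\<nu>\<in>L - {\<mu>}. [:-\<nu>, 1:]) (card L - 1) = lead_coeff (\<Prod>\<nu>\<in>L - {\<mu>}. [:-\<nu>, 1:])"
      by (simp only: degree_pole_product[OF that])
    also have "\<dots> = 1"
      by (simp only: lead_coeff_prod) simp
    finally show ?thesis .
  qed
  thus ?thesis by (simp add: numer_def coeff_sum sum_weights)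
qed

lemma numer_neq_0: "numer \<noteq> 0"
  using coeff_numer by auto

lemma proots_numer_denom_disjoint: "proots denom \<inter># proots numer = {#}"
proof -
  have "poly numer \<mu> \<noteq> 0" if "\<mu> \<in> L" for \<mu>
    using poly_numer_pole[OF that] weight_gt_0[OF that] finite_poles by auto
  hence "set_mset (proots denom) \<inter> set_mset (proots numer) = {}"
    using finite_poles by (auto simp: proots_denom set_count_proots numer_neq_0)
  thus ?thesis by (simp add: disjunct_not_in disjoint_iff)
qed

text \<open>Agreement off the finite set \<open>L\<close> forces
  \<open>p0 * denom = p * numer\<close>. As \<open>denom\<close> and \<open>numer\<close> share no
  root, comparing multiplicities shows that their roots are what is left of \<open>p\<close> and
  \<open>p0\<close> once the common part is removed.\<close>

lemma proots_diff_common: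
  assumes "p \<noteq> 0" "p0 \<noteq> 0"
    and "\<And>z. z \<notin> L \<Longrightarrow> poly p0 z = poly p z * (\<Sum>\<mu>\<in>L. W \<mu> / (z - \<mu>))"
  shows "proots p - proots p \<inter># proots p0 = mset_set L"
    and "proots p0 - proots p \<inter># proots p0 = proots numer"
proof -
  have "p0 * denom = p * numer"
  proof (rule ccontr)
    assume "p0 * denom \<noteq> p * numer"
    hence "finite {z. poly (p0 * denom - p * numer) z = 0}" by (intro poly_roots_finite) auto
    moreover have "- L \<subseteq> {z. poly (p0 * denom - p * numer) z = 0}"
      using assms(3) by (auto simp: poly_numer_eq)
    ultimately have "finite (- L)" by (rule finite_subset[rotated])
    thus False using finite_poles by (simp add: finite_compl infinite_UNIV_char_0)
  qed
  hence "proots (p0 * denom) = proots (p * numer)" by simp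
  hence eq: "proots p0 + proots denom = proots p + proots numer"
    using assms(1,2) denom_neq_0 numer_neq_0 by (simp add: proots_mult)
  have *: "B = M - M \<inter># N \<and> C = N - M \<inter># N" if "N + B = M + C" "B \<inter># C = {#}"
    for M N B C :: "real multiset"
  proof -
    have "count N x + count B x = count M x + count C x" "min (count B x) (count C x) = 0" for x
      using arg_cong[OF that(1), of "\<lambda>M. count M x"] arg_cong[OF that(2), of "\<lambda>M. count M x"] by auto
    moreover have "b = m - min m k \<and> c = k - min m k" if "k + b = m + c" "min b c = 0" for m k b c :: nat
      using that by (auto simp: min_def split: if_splits)
    ultimately have "count B x = count M x - min (count M x) (count N x) \<and>
        count C x = count N x - min (count M x) (count N x)" for x
      by blast
    thus ?thesis by (auto simp: multiset_eq_iff)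
  qed
  from *[OF eq proots_numer_denom_disjoint]
  show "proots p - proots p \<inter># proots p0 = mset_set L" "proots p0 - proots p \<inter># proots p0 = proots numer"
    by (simp_all add: proots_denom)
qed

text \<open>At consecutive poles \<open>numer\<close> has opposite signs, so each gap contains a root, and these
  exhaust its degree.\<close>

lemma interlacing:
  obtains r l g where "card L = Suc r" and "L = l ` {..r}"
    and "\<And>i. i \<le> r \<Longrightarrow> rev (sorted_list_of_set L) ! i = l i"
    and "\<And>i j. i < j \<Longrightarrow> j \<le> r \<Longrightarrow> l j < l i"
    and "\<And>i. i \<in> {1..r} \<Longrightarrow> l i < g i \<and> g i < l (i - 1)"
    and "numer = (\<Prod>i\<in>{1..r}. [:- g i, 1:])"
proof -
  define r where "r = card L - 1"
  have "L \<noteq> {}" using sum_weights by auto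
  hence card: "card L = Suc r" using finite_poles by (simp add: r_def card_gt_0_iff)
  define l where "l i = rev (sorted_list_of_set L) ! i" for i
  have l_less: "l j < l i" if "i < j" "j \<le> r" for i j
    using that card sorted_wrt_nth_less[OF strict_sorted_list_of_set[of L], of "r - j" "r - i"]
    by (simp add: l_def rev_nth)
  have L: "L = l ` {..r}"
  proof -
    have "L = set (rev (sorted_list_of_set L))" using finite_poles by simp
    also have "\<dots> = l ` {..<length (rev (sorted_list_of_set L))}"
      unfolding l_def by (auto simp: set_conv_nth)
    finally show ?thesis using card by (simp add: lessThan_Suc_atMost)
  qed
  have inj: "inj_on l {..r}"
    by (rule inj_onI) (metis atMost_iff l_less less_irrefl linorder_neqE_nat)
  \<comment> \<open>Among the factors \<open>l k - l j\<close>, exactly the \<open>k\<close> ones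
    with \<open>j < k\<close> are negative.\<close>
  have sign: "0 < (-1) ^ k * poly numer (l k)" if "k \<le> r" for k
  proof -
    have "L - {l k} = l ` ({..r} - {k})"
      using inj that by (subst L) (auto simp: inj_on_def)
    hence "(\<Prod>\<nu>\<in>L - {l k}. l k - \<nu>) = (\<Prod>j\<in>{..r} - {k}. l k - l j)"
      using inj by (simp add: prod.reindex inj_on_diff)
    also have "{..r} - {k} = {..<k} \<union> {k<..r}" using that by auto
    also have "(\<Prod>j\<in>{..<k} \<union> {k<..r}. l k - l j) = (\<Prod>j<k. l k - l j) * (\<Prod>j\<in>{k<..r}. l k - l j)"
      by (intro prod.union_disjoint) auto
    also have "(\<Prod>j<k. l k - l j) = (\<Prod>j<k. (-1) * (l j - l k))" by simp
    also have "\<dots> = (-1) ^ k * (\<Prod>j<k. l j - l k)" by (subst prod.distrib) simp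
    finally have "(-1) ^ k * poly numer (l k) =
        ((-1) ^ k * (-1) ^ k) * (W (l k) * (\<Prod>j<k. l j - l k) * (\<Prod>j\<in>{k<..r}. l k - l j))"
      using that by (subst poly_numer_pole) (auto simp: L)
    also have "(-1) ^ k * (-1) ^ k = (1 :: real)" by (simp flip: power_mult_distrib)
    also have "0 < 1 * (W (l k) * (\<Prod>j<k. l j - l k) * (\<Prod>j\<in>{k<..r}. l k - l j))"
      unfolding mult_1 using that l_less
      by (intro mult_pos_pos prod_pos weight_gt_0) (auto simp: L)
    finally show ?thesis .
  qed
  have "\<exists>g. l i < g \<and> g < l (i - 1) \<and> poly numer g = 0" if "i \<in> {1..r}" for i
  proof -
    define k where "k = i - 1"
    have k: "i = Suc k" "Suc k \<le> r" using that by (auto simp: k_def)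
    have "0 < ((-1) ^ k * poly numer (l k)) * ((-1) ^ Suc k * poly numer (l (Suc k)))"
      using k by (intro mult_pos_pos sign) auto
    also have "\<dots> = - ((-1) ^ k * (-1) ^ k) * (poly numer (l (Suc k)) * poly numer (l k))"
      by simp
    also have "(-1) ^ k * (-1) ^ k = (1 :: real)" by (simp flip: power_mult_distrib)
    finally have "poly numer (l (Suc k)) * poly numer (l k) < 0" by simp
    from poly_IVT[OF _ this] l_less[of k "Suc k"] k show ?thesis by auto
  qed
  then obtain g where g: "\<And>i. i \<in> {1..r} \<Longrightarrow> l i < g i \<and> g i < l (i - 1) \<and> poly numer (g i) = 0"
    by metis
  \<comment> \<open>Different gaps between poles are disjoint, so the chosen roots are
    distinct.\<close>
  have "g i \<noteq> g j" if "i \<in> {1..r}" "j \<in> {1..r}" "i < j" for i j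
  proof -
    have "g j < l (j - 1)" "l i < g i" using g that by auto
    moreover have "i = j - 1 \<or> i < j - 1 \<and> j - 1 \<le> r" using that by auto
    hence "l (j - 1) \<le> l i" using l_less[of i "j - 1"] by auto
    ultimately show ?thesis by simp
  qed
  hence inj_g: "inj_on g {1..r}" by (metis (no_types, lifting) inj_onI linorder_neqE_nat)
  have deg: "degree (\<Prod>i\<in>{1..r}. [:- g i, 1:]) = r"
    by (subst degree_prod_sum_eq) auto
  have "lead_coeff (\<Prod>i\<in>{1..r}. [:- g i, 1:]) = 1"
    by (simp only: lead_coeff_prod) simp
  hence coeff: "coeff (\<Prod>i\<in>{1..r}. [:- g i, 1:]) r = 1" by (simp only: deg)
  \<comment> \<open>Both sides have degree at most \<open>r\<close>, coefficient one at
    \<open>r\<close>, and the same values at \<open>r\<close> distinct points.\<close>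
  have numer: "numer = (\<Prod>i\<in>{1..r}. [:- g i, 1:])"
  proof (rule poly_eqI_degree_lead_coeff[where A = "g ` {1..r}" and n = r])
    show "r \<le> card (g ` {1..r})" using inj_g by (simp add: card_image)
    show "poly numer z = poly (\<Prod>i\<in>{1..r}. [:- g i, 1:]) z" if z: "z \<in> g ` {1..r}" for z
    proof -
      obtain i where "i \<in> {1..r}" "z = g i" using z by auto
      thus ?thesis using g[of i] by (auto simp: poly_prod intro!: bexI[of _ i])
    qed
  qed (use degree_numer_le coeff_numer coeff deg in \<open>auto simp: r_def\<close>)
  show thesis
  proof (rule that[of r l g])
    show "rev (sorted_list_of_set L) ! i = l i" for i by (simp add: l_def)
    show "l i < g i \<and> g i < l (i - 1)" if "i \<in> {1..r}" for i using g that by blast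
  qed (fact card L l_less numer)+
qed

text \<open>The geometric series of \<open>\<mu>\<close> cancels the factor for \<open>\<mu>\<close>
  in the product. What remains is \<open>numer\<close> with its coefficients reversed, and reversal
  turns each root factor of \<open>numer\<close> into \<open>1 - g i z\<close>.\<close>

lemma power_sums_mult_linear_factors:
  assumes "numer = (\<Prod>i\<in>I. [:- g i, 1:])" and "card I = card L - 1"
  shows "Abs_fps (\<lambda>k. \<Sum>\<mu>\<in>L. W \<mu> * \<mu> ^ k) * (\<Prod>\<mu>\<in>L. 1 - fps_const \<mu> * fps_X) =
    (\<Prod>i\<in>I. 1 - fps_const (g i) * fps_X)"
proof -
  have geo: "Abs_fps (\<lambda>k. \<mu> ^ k) * (1 - fps_const \<mu> * fps_X) = 1" for \<mu> :: real
  proof (rule fps_ext)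
    fix k
    have "Abs_fps (\<lambda>k. \<mu> ^ k) * (1 - fps_const \<mu> * fps_X) =
        Abs_fps (\<lambda>k. \<mu> ^ k) - fps_const \<mu> * (fps_X * Abs_fps (\<lambda>k. \<mu> ^ k))"
      by (simp add: algebra_simps)
    thus "fps_nth (Abs_fps (\<lambda>k. \<mu> ^ k) * (1 - fps_const \<mu> * fps_X)) k = fps_nth 1 k"
      by (cases k) simp_all
  qed
  have linear: "fps_of_poly [:1, - x:] = 1 - fps_const x * fps_X" for x :: real
    by (rule fps_ext) (simp add: coeff_pCons split: nat.split)
  have "Abs_fps (\<lambda>k. \<Sum>\<mu>\<in>L. W \<mu> * \<mu> ^ k) = (\<Sum>\<mu>\<in>L. fps_const (W \<mu>) * Abs_fps (\<lambda>k. \<mu> ^ k))"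
    by (rule fps_ext) (simp add: fps_sum_nth)
  hence "Abs_fps (\<lambda>k. \<Sum>\<mu>\<in>L. W \<mu> * \<mu> ^ k) * (\<Prod>\<mu>\<in>L. 1 - fps_const \<mu> * fps_X) =
      (\<Sum>\<mu>\<in>L. fps_const (W \<mu>) * Abs_fps (\<lambda>k. \<mu> ^ k) * (\<Prod>\<nu>\<in>L. 1 - fps_const \<nu> * fps_X))"
    by (simp add: sum_distrib_right)
  also have "\<dots> = (\<Sum>\<mu>\<in>L. fps_const (W \<mu>) * (\<Prod>\<nu>\<in>L - {\<mu>}. 1 - fps_const \<nu> * fps_X))"
  proof (intro sum.cong refl)
    fix \<mu> assume "\<mu> \<in> L"
    have "fps_const (W \<mu>) * Abs_fps (\<lambda>k. \<mu> ^ k) * (\<Prod>\<nu>\<in>L. 1 - fps_const \<nu> * fps_X) =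
      fps_const (W \<mu>) * (Abs_fps (\<lambda>k. \<mu> ^ k) * (1 - fps_const \<mu> * fps_X)) *
        (\<Prod>\<nu>\<in>L - {\<mu>}. 1 - fps_const \<nu> * fps_X)"
      using finite_poles \<open>\<mu> \<in> L\<close> by (simp add: prod.remove mult_ac)
    thus "fps_const (W \<mu>) * Abs_fps (\<lambda>k. \<mu> ^ k) * (\<Prod>\<nu>\<in>L. 1 - fps_const \<nu> * fps_X) =
      fps_const (W \<mu>) * (\<Prod>\<nu>\<in>L - {\<mu>}. 1 - fps_const \<nu> * fps_X)" by (simp add: geo)
  qed
  also have "\<dots> = fps_of_poly (\<Sum>\<mu>\<in>L. Polynomial.smult (W \<mu>) (\<Prod>\<nu>\<in>L - {\<mu>}. [:1, - \<nu>:]))"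
    by (simp add: fps_of_poly_sum fps_of_poly_prod fps_of_poly_smult linear)
  also have "(\<Sum>\<mu>\<in>L. Polynomial.smult (W \<mu>) (\<Prod>\<nu>\<in>L - {\<mu>}. [:1, - \<nu>:])) = (\<Prod>i\<in>I. [:1, - g i:])"
    (is "?lhs = ?rhs")
  proof (rule ccontr)
    assume "?lhs \<noteq> ?rhs"
    hence "finite {z. poly (?lhs - ?rhs) z = 0}" by (intro poly_roots_finite) auto
    moreover have "poly ?lhs z = poly ?rhs z" if "z \<noteq> 0" for z
    proof -
      have factor: "1 - z * x = z * (1 / z - x)" for x using that by (simp add: field_simps)
      have "poly ?lhs z = (\<Sum>\<mu>\<in>L. W \<mu> * (\<Prod>\<nu>\<in>L - {\<mu>}. z * (1 / z - \<nu>)))"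
        by (simp add: poly_sum poly_prod factor)
      also have "\<dots> = z ^ (card L - 1) * poly numer (1 / z)"
        unfolding poly_numer sum_distrib_left using finite_poles
        by (intro sum.cong refl) (simp add: prod.distrib)
      also have "\<dots> = poly ?rhs z"
        using assms(2) by (simp add: assms(1) poly_prod factor prod.distrib)
      finally show ?thesis .
    qed
    hence "- {0} \<subseteq> {z. poly (?lhs - ?rhs) z = 0}" by auto
    ultimately have "finite (- {0 :: real})" by (rule finite_subset[rotated])
    thus False by (simp add: finite_compl infinite_UNIV_char_0)
  qed
  also have "fps_of_poly \<dots> = (\<Prod>i\<in>I. 1 - fps_const (g i) * fps_X)"
    by (simp add: fps_of_poly_prod linear)
  finally show ?thesis .
qed

end

section \<open>Generating functions of laws on the natural numbers\<close>

text \<open>The probability generating function, taken as a formal power series so that no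
  convergence has to be discussed.\<close>

definition pmf_fps :: "nat pmf \<Rightarrow> real fps" where
  "pmf_fps p = Abs_fps (pmf p)"

lemma pmf_fps_return_0: "pmf_fps (return_pmf 0) = 1"
  by (rule fps_ext) (simp add: pmf_fps_def)

lemma pmf_fps_add:
  "pmf_fps (map_pmf (\<lambda>(x, y). x + y) (pair_pmf p q)) = pmf_fps p * pmf_fps q"
proof (rule fps_ext)
  fix k
  have "pmf (map_pmf (\<lambda>(x, y). x + y) (pair_pmf p q)) k =
      measure (pair_pmf p q) ((\<lambda>i. (i, k - i)) ` {0..k})"
    unfolding pmf_map by (rule arg_cong[of _ _ "measure (pair_pmf p q)"]) (auto simp: image_iff)
  also have "\<dots> = (\<Sum>i=0..k. pmf p i * pmf q (k - i))"
    by (subst measure_measure_pmf_finite) (auto simp: sum.reindex inj_on_def pmf_pair)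
  finally show "fps_nth (pmf_fps (map_pmf (\<lambda>(x, y). x + y) (pair_pmf p q))) k =
      fps_nth (pmf_fps p * pmf_fps q) k"
    by (simp add: pmf_fps_def fps_mult_nth)
qed

text \<open>Splitting off one coordinate leaves a sum of two independent variables, whose law is a
  convolution.\<close>

lemma pmf_fps_Pi_pmf_sum:
  assumes "finite I"
  shows "pmf_fps (map_pmf (\<lambda>Y. \<Sum>i\<in>I. Y i) (Pi_pmf I 0 p)) = (\<Prod>i\<in>I. pmf_fps (p i))"
  using assms
proof (induction I)
  case empty
  show ?case by (simp add: pmf_fps_return_0)
next
  case (insert j I)
  have "(\<Sum>i\<in>insert j I. (f(j := y)) i) = y + (\<Sum>i\<in>I. f i)" for y :: nat and f
    using insert.hyps by (simp add: sum.insert) (intro sum.cong; auto)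
  hence "map_pmf (\<lambda>Y. \<Sum>i\<in>insert j I. Y i) (Pi_pmf (insert j I) 0 p) =
      map_pmf (\<lambda>(y, f). y + (\<Sum>i\<in>I. f i)) (pair_pmf (p j) (Pi_pmf I 0 p))"
    using insert.hyps by (simp add: Pi_pmf_insert map_pmf_comp case_prod_unfold)
  also have "\<dots> = map_pmf (\<lambda>(x, y). x + y) (map_pmf (apsnd (\<lambda>f. \<Sum>i\<in>I. f i)) (pair_pmf (p j) (Pi_pmf I 0 p)))"
    by (simp add: map_pmf_comp case_prod_unfold)
  also have "map_pmf (apsnd (\<lambda>f. \<Sum>i\<in>I. f i)) (pair_pmf (p j) (Pi_pmf I 0 p)) =
      pair_pmf (p j) (map_pmf (\<lambda>f. \<Sum>i\<in>I. f i) (Pi_pmf I 0 p))"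
    by (simp add: pair_map_pmf2)
  finally show ?case using insert by (simp add: pmf_fps_add)
qed

lemma pmf_Geo: "0 < p \<Longrightarrow> p \<le> 1 \<Longrightarrow> pmf (Geo p) k = (if k = 0 then 0 else p * (1 - p) ^ (k - 1))"
proof (cases k)
  case (Suc m)
  assume "0 < p" "p \<le> 1"
  thus ?thesis using pmf_map_inj'[of Suc "geometric_pmf p" m] by (simp add: Geo_def Suc pmf_geometric)
next
  case 0
  thus ?thesis by (simp add: Geo_def pmf_eq_0_set_pmf)
qed

text \<open>The factor \<open>1 - g z\<close> cancels the geometric tail, leaving a linear
  polynomial. Its coefficient at \<open>z\<close> is \<open>(1 - w) * (1 - g) - w * g\<close>, and
  the mixing weight \<open>w\<close> is the one for which this is \<open>- w * l\<close>.\<close>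

lemma pmf_fps_modified_geometric:
  assumes "0 \<le> g" "g < 1" "l \<le> g"
  shows "pmf_fps (modified_geometric g l) * (1 - fps_const g * fps_X) =
    fps_const ((1 - g) / (1 - l)) * (1 - fps_const l * fps_X)"
proof -
  define w where "w = (1 - g) / (1 - l)"
  have "w * (1 - l) = 1 - g" using assms by (simp add: w_def)
  hence w: "(1 - w) * (1 - g) - w * g = - w * l" by (simp add: algebra_simps)
  have w01: "0 \<le> w" "w \<le> 1" using assms by (auto simp: w_def)
  have pmf: "pmf (modified_geometric g l) k = (if k = 0 then w else (1 - w) * ((1 - g) * g ^ (k - 1)))" for k
    using assms w01 unfolding modified_geometric_def w_def[symmetric]
    by (simp add: pmf_bind pmf_Geo)
  have "pmf_fps (modified_geometric g l) * (1 - fps_const g * fps_X) =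
      pmf_fps (modified_geometric g l) - fps_const g * (fps_X * pmf_fps (modified_geometric g l))"
    by (simp add: algebra_simps)
  also have "\<dots> = fps_const w * (1 - fps_const l * fps_X)"
  proof (rule fps_ext)
    fix k
    consider "k = 0" | "k = 1" | m where "k = Suc (Suc m)" by (metis One_nat_def not0_implies_Suc)
    thus "fps_nth (pmf_fps (modified_geometric g l) - fps_const g * (fps_X * pmf_fps (modified_geometric g l))) k =
        fps_nth (fps_const w * (1 - fps_const l * fps_X)) k"
      by cases (use w in \<open>auto simp: pmf_fps_def pmf algebra_simps\<close>)
  qed
  finally show ?thesis by (simp add: w_def)
qed

section \<open>Hitting times of stationary Markov chains\<close>

lemma pow_mat_Suc_index:
  assumes "P \<in> carrier_mat (Suc n) (Suc n)" "i \<le> n" "j \<le> n"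
  shows "(P ^\<^sub>m Suc k) $$ (i, j) = (\<Sum>l\<le>n. (P ^\<^sub>m k) $$ (i, l) * P $$ (l, j))"
  using assms pow_carrier_mat[OF assms(1), of k]
  by (simp add: scalar_prod_def atLeast0LessThan lessThan_Suc_atMost del: sum.op_ivl_Suc sum.lessThan_Suc)

lemma pow_mat_0_index:
  assumes "P \<in> carrier_mat (Suc n) (Suc n)" "i \<le> n" "j \<le> n"
  shows "(P ^\<^sub>m 0) $$ (i, j) = (if i = j then 1 else 0)"
  using assms by simp

lemma pow_mat_eigenvector:
  fixes P :: "'a :: comm_ring_1 mat"
  assumes P: "P \<in> carrier_mat (Suc n) (Suc n)"
    and eig: "\<And>i. i \<le> n \<Longrightarrow> (\<Sum>j\<le>n. P $$ (i, j) * f j) = c * f i"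
    and "i \<le> n"
  shows "(\<Sum>j\<le>n. (P ^\<^sub>m k) $$ (i, j) * f j) = c ^ k * f i"
proof (induction k)
  case 0
  have "(\<Sum>j\<le>n. (P ^\<^sub>m 0) $$ (i, j) * f j) = (\<Sum>j\<le>n. if i = j then f j else 0)"
    using assms by (intro sum.cong refl) (simp add: pow_mat_0_index del: pow_mat.simps)
  thus ?case using assms by simp
next
  case (Suc k)
  have "(\<Sum>j\<le>n. (P ^\<^sub>m Suc k) $$ (i, j) * f j) =
      (\<Sum>j\<le>n. \<Sum>l\<le>n. (P ^\<^sub>m k) $$ (i, l) * P $$ (l, j) * f j)"
    using assms by (intro sum.cong refl) (simp add: pow_mat_Suc_index sum_distrib_right del: pow_mat.simps)
  also have "\<dots> = (\<Sum>l\<le>n. (P ^\<^sub>m k) $$ (i, l) * (\<Sum>j\<le>n. P $$ (l, j) * f j))"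
    by (subst sum.swap) (simp add: sum_distrib_left mult.assoc)
  also have "\<dots> = (\<Sum>l\<le>n. c * ((P ^\<^sub>m k) $$ (i, l) * f l))"
    by (intro sum.cong refl) (simp add: eig mult.left_commute)
  also have "\<dots> = c ^ Suc k * f i"
    using Suc.IH by (simp add: sum_distrib_left[symmetric] mult_ac)
  finally show ?case .
qed

section \<open>Irreducible chains: positivity, maximum principle and the eigenvalue one\<close>

locale irreducible_chain =
  fixes n :: nat and P :: "real mat" and \<pi> :: "nat \<Rightarrow> real"
  assumes stochastic: "stochastic_matrix n P"
    and irreducible: "irreducible_matrix n P"
    and stationary: "stationary_distribution n P \<pi>"
begin

lemma carrier: "P \<in> carrier_mat (Suc n) (Suc n)"
  using stochastic by (simp add: stochastic_matrix_def)

lemma P_nonneg: "i \<le> n \<Longrightarrow> j \<le> n \<Longrightarrow> 0 \<le> P $$ (i, j)"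
  using stochastic by (simp add: stochastic_matrix_def)

lemma P_row_sum: "i \<le> n \<Longrightarrow> (\<Sum>j\<le>n. P $$ (i, j)) = 1"
  using stochastic by (simp add: stochastic_matrix_def atLeast0AtMost)

lemma \<pi>_P: "j \<le> n \<Longrightarrow> (\<Sum>i\<le>n. \<pi> i * P $$ (i, j)) = \<pi> j"
  using stationary by (simp add: stationary_distribution_def atLeast0AtMost)

lemma \<pi>_sum: "(\<Sum>i\<le>n. \<pi> i) = 1"
  using stationary by (simp add: stationary_distribution_def atLeast0AtMost)

lemma \<pi>_nonneg: "i \<le> n \<Longrightarrow> 0 \<le> \<pi> i"
  using stationary by (simp add: stationary_distribution_def)

lemma pow_nonneg: "i \<le> n \<Longrightarrow> j \<le> n \<Longrightarrow> 0 \<le> (P ^\<^sub>m k) $$ (i, j)"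
proof (induction k arbitrary: j)
  case 0
  thus ?case by (simp add: pow_mat_0_index[OF carrier] del: pow_mat.simps)
next
  case (Suc k)
  thus ?case
    unfolding pow_mat_Suc_index[OF carrier Suc.prems]
    by (intro sum_nonneg mult_nonneg_nonneg) (auto simp: P_nonneg)
qed

lemma \<pi>_pow: "j \<le> n \<Longrightarrow> (\<Sum>i\<le>n. \<pi> i * (P ^\<^sub>m k) $$ (i, j)) = \<pi> j"
proof (induction k arbitrary: j)
  case 0
  have "(\<Sum>i\<le>n. \<pi> i * (P ^\<^sub>m 0) $$ (i, j)) = (\<Sum>i\<le>n. if i = j then \<pi> i else 0)"
    using 0 by (intro sum.cong refl) (simp add: pow_mat_0_index[OF carrier] del: pow_mat.simps)
  thus ?case using 0 by simp
next
  case (Suc k)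
  have "(\<Sum>i\<le>n. \<pi> i * (P ^\<^sub>m Suc k) $$ (i, j)) =
      (\<Sum>i\<le>n. \<Sum>l\<le>n. \<pi> i * (P ^\<^sub>m k) $$ (i, l) * P $$ (l, j))"
    using Suc.prems
    by (intro sum.cong refl) (simp add: pow_mat_Suc_index[OF carrier] sum_distrib_left mult.assoc del: pow_mat.simps)
  also have "\<dots> = (\<Sum>l\<le>n. (\<Sum>i\<le>n. \<pi> i * (P ^\<^sub>m k) $$ (i, l)) * P $$ (l, j))"
    by (subst sum.swap) (simp add: sum_distrib_right)
  also have "\<dots> = (\<Sum>l\<le>n. \<pi> l * P $$ (l, j))"
    by (intro sum.cong refl) (simp add: Suc.IH)
  finally show ?case using \<pi>_P[OF Suc.prems] by simp
qed

text \<open>Some state has positive mass, a power of \<open>P\<close> carries part of it to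
  \<open>j\<close>, and \<open>\<pi>\<close> is invariant under that power.\<close>

lemma \<pi>_pos:
  assumes "j \<le> n"
  shows "0 < \<pi> j"
proof -
  obtain i where i: "i \<le> n" "0 < \<pi> i"
  proof (rule ccontr)
    assume "\<not> thesis"
    hence "\<pi> i = 0" if "i \<le> n" for i using \<pi>_nonneg[OF that] that \<open>\<not> thesis\<close> \<open>\<And>i. _ \<Longrightarrow> _ \<Longrightarrow> thesis\<close> by force
    thus False using \<pi>_sum by simp
  qed
  obtain k where "0 < (P ^\<^sub>m k) $$ (i, j)"
    using irreducible i assms unfolding irreducible_matrix_def by (metis atLeastAtMost_iff le0)
  hence "0 < \<pi> i * (P ^\<^sub>m k) $$ (i, j)" using i by simp
  also have "\<dots> \<le> (\<Sum>i\<le>n. \<pi> i * (P ^\<^sub>m k) $$ (i, j))"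
    using i assms \<pi>_nonneg pow_nonneg by (intro member_le_sum) auto
  finally show ?thesis using \<pi>_pow[OF assms] by simp
qed

lemma exists_maximum:
  fixes f :: "nat \<Rightarrow> real"
  obtains m where "m \<le> n" "\<And>i. i \<le> n \<Longrightarrow> f i \<le> f m"
proof -
  have "Max (f ` {..n}) \<in> f ` {..n}" by (intro Max_in) auto
  then obtain m where "m \<in> {..n}" "Max (f ` {..n}) = f m" by (rule imageE)
  moreover have "f i \<le> Max (f ` {..n})" if "i \<le> n" for i using that by (intro Max_ge) auto
  ultimately show thesis using that[of m] by simp
qed

text \<open>Maximum principle: at a maximum point \<open>m\<close>, the function
  \<open>f m - f\<close> is nonnegative and harmonic with value zero, so its average under row
  \<open>m\<close> of every power vanishes. Every state is reached from \<open>m\<close> with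
  positive probability.\<close>

lemma harmonic_imp_constant:
  assumes harmonic: "\<And>i. i \<le> n \<Longrightarrow> (\<Sum>j\<le>n. P $$ (i, j) * f j) = f i"
    and "i \<le> n" "j \<le> n"
  shows "f i = f j"
proof -
  obtain m where m: "m \<le> n" "\<And>i. i \<le> n \<Longrightarrow> f i \<le> f m" using exists_maximum[of f] by blast
  have "f i = f m" if i: "i \<le> n" for i
  proof -
    obtain k where k: "0 < (P ^\<^sub>m k) $$ (m, i)"
      using irreducible m(1) i unfolding irreducible_matrix_def by (metis atLeastAtMost_iff le0)
    have "(\<Sum>j\<le>n. (P ^\<^sub>m k) $$ (m, j) * (f m - f j)) = 1 ^ k * (f m - f m)"
      using m(1) harmonic P_row_sum
      by (intro pow_mat_eigenvector[OF carrier])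
        (simp_all add: right_diff_distrib sum_subtractf flip: sum_distrib_right)
    hence "(\<Sum>j\<le>n. (P ^\<^sub>m k) $$ (m, j) * (f m - f j)) = 0" by simp
    hence "\<forall>j\<in>{..n}. (P ^\<^sub>m k) $$ (m, j) * (f m - f j) = 0"
      using m pow_nonneg by (subst (asm) sum_nonneg_eq_0_iff) auto
    from bspec[OF this, of i] k i show ?thesis by simp
  qed
  from this[of i] this[of j] assms show ?thesis by simp
qed

text \<open>Evaluate the eigenvector equation at a maximum of \<open>f\<close>, which is positive
  because \<open>f 0\<close> is.\<close>

lemma eigenvalue_le_1:
  assumes eig: "\<And>i. i \<le> n \<Longrightarrow> (\<Sum>j\<le>n. P $$ (i, j) * f j) = \<mu> * f i" and "0 < f 0"
  shows "\<mu> \<le> 1"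
proof -
  obtain m where m: "m \<le> n" "\<And>i. i \<le> n \<Longrightarrow> f i \<le> f m" using exists_maximum[of f] by blast
  have pos: "0 < f m" using m(2)[of 0] assms by simp
  have "\<mu> * f m = (\<Sum>j\<le>n. P $$ (m, j) * f j)" using eig m by simp
  also have "\<dots> \<le> (\<Sum>j\<le>n. P $$ (m, j) * f m)"
    using m P_nonneg by (intro sum_mono mult_left_mono) auto
  also have "\<dots> = f m" using P_row_sum m by (simp flip: sum_distrib_right)
  finally show ?thesis using pos by simp
qed

text \<open>\<open>\<pi>\<close> is a left eigenvector for the eigenvalue 1, hence annihilates right
  eigenvectors for other eigenvalues.\<close>

lemma \<pi>_eigenvector:
  assumes eig: "\<And>i. i \<le> n \<Longrightarrow> (\<Sum>j\<le>n. P $$ (i, j) * f j) = \<mu> * f i" and "\<mu> \<noteq> 1"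
  shows "(\<Sum>i\<le>n. \<pi> i * f i) = 0"
proof -
  have "\<mu> * (\<Sum>i\<le>n. \<pi> i * f i) = (\<Sum>i\<le>n. \<pi> i * (\<mu> * f i))"
    by (simp add: sum_distrib_left mult.left_commute)
  also have "\<dots> = (\<Sum>i\<le>n. \<pi> i * (\<Sum>j\<le>n. P $$ (i, j) * f j))"
    by (intro sum.cong refl) (simp add: eig)
  also have "\<dots> = (\<Sum>j\<le>n. (\<Sum>i\<le>n. \<pi> i * P $$ (i, j)) * f j)"
    unfolding sum_distrib_left sum_distrib_right by (subst sum.swap) (simp add: mult.assoc)
  also have "\<dots> = (\<Sum>i\<le>n. \<pi> i * f i)"
    by (intro sum.cong refl) (simp add: \<pi>_P)
  finally show ?thesis using assms(2) by simp
qed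

text \<open>Integrate the expansion of the unit vector at 0 against \<open>\<pi>\<close>. Only the
  eigenvalue 1 can contribute, so positivity of \<open>\<pi> 0\<close> puts it into
  \<open>L\<close>; its eigenvector is constant by the maximum principle.\<close>

lemma unit_eigenvalue:
  assumes fin: "finite L"
    and eig: "\<And>\<mu> i. \<mu> \<in> L \<Longrightarrow> i \<le> n \<Longrightarrow> (\<Sum>j\<le>n. P $$ (i, j) * u \<mu> j) = \<mu> * u \<mu> i"
    and sum_u: "\<And>i. i \<le> n \<Longrightarrow> (\<Sum>\<mu>\<in>L. u \<mu> i) = (if i = 0 then 1 else 0)"
  shows "1 \<in> L" and "u 1 0 = \<pi> 0"
proof -
  have "\<pi> 0 = (\<Sum>i\<le>n. \<pi> i * (if i = 0 then 1 else 0))" by (simp add: if_distrib cong: if_cong)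
  also have "\<dots> = (\<Sum>i\<le>n. \<pi> i * (\<Sum>\<mu>\<in>L. u \<mu> i))" by (intro sum.cong refl) (simp add: sum_u)
  also have "\<dots> = (\<Sum>\<mu>\<in>L. \<Sum>i\<le>n. \<pi> i * u \<mu> i)"
    unfolding sum_distrib_left by (rule sum.swap)
  also have "\<dots> = (\<Sum>\<mu>\<in>L. if \<mu> = 1 then (\<Sum>i\<le>n. \<pi> i * u \<mu> i) else 0)"
  proof (intro sum.cong refl)
    fix \<mu> assume "\<mu> \<in> L"
    thus "(\<Sum>i\<le>n. \<pi> i * u \<mu> i) = (if \<mu> = 1 then (\<Sum>i\<le>n. \<pi> i * u \<mu> i) else 0)"
      using \<pi>_eigenvector[of "u \<mu>" \<mu>] eig by simp
  qed
  also have "\<dots> = (if 1 \<in> L then (\<Sum>i\<le>n. \<pi> i * u 1 i) else 0)"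
    using fin by (simp add: sum.delta)
  finally have eq: "\<pi> 0 = (if 1 \<in> L then (\<Sum>i\<le>n. \<pi> i * u 1 i) else 0)" .
  thus one: "1 \<in> L" using \<pi>_pos[of 0] by (auto split: if_splits)
  have const: "u 1 i = u 1 0" if "i \<le> n" for i
    using harmonic_imp_constant[of "u 1" i 0] eig[OF one] that by simp
  have "(\<Sum>i\<le>n. \<pi> i * u 1 i) = (\<Sum>i\<le>n. \<pi> i * u 1 0)"
    by (intro sum.cong refl, subst const) auto
  also have "\<dots> = u 1 0" using \<pi>_sum by (simp flip: sum_distrib_right)
  finally show "u 1 0 = \<pi> 0" using eq one by simp
qed

end

section \<open>First passage to state 0\<close>

locale stationary_markov_chain = irreducible_chain n P \<pi>
  for n :: nat and P :: "real mat" and \<pi> :: "nat \<Rightarrow> real" +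
  fixes M :: "'w measure" and X :: "nat \<Rightarrow> 'w \<Rightarrow> nat"
  assumes chain: "markov_chain n P \<pi> M X"

sublocale stationary_markov_chain \<subseteq> prob_space M
  using chain by (simp add: markov_chain_def)

context stationary_markov_chain
begin

lemma X_measurable [measurable]: "X t \<in> measurable M (count_space UNIV)"
proof -
  have "X t \<in> measurable M (count_space {0..n})" using chain by (simp add: markov_chain_def)
  from measurable_compose[OF this, of "\<lambda>x. x" "count_space UNIV"] show ?thesis by simp
qed

lemma X_le:
  assumes "\<omega> \<in> space M"
  shows "X t \<omega> \<le> n"
proof -
  have "X t \<in> measurable M (count_space {0..n})" using chain by (simp add: markov_chain_def)
  from measurable_space[OF this assms] show ?thesis by simp
qed

definition first_hit :: "nat \<Rightarrow> real" where
  "first_hit k = \<P>(\<omega> in M. (\<forall>s<k. X s \<omega> \<noteq> 0) \<and> X k \<omega> = 0)"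

text \<open>Time \<open>k\<close> itself is included among the times avoiding 0, in contrast to
  \<open>first_hit\<close>, so the value at \<open>i = 0\<close> is zero.\<close>

definition taboo :: "nat \<Rightarrow> nat \<Rightarrow> real" where
  "taboo k i = \<P>(\<omega> in M. (\<forall>s\<le>k. X s \<omega> \<noteq> 0) \<and> X k \<omega> = i)"

text \<open>The Markov property speaks only about histories of positive probability; for null
  histories both sides vanish.\<close>

lemma path_step:
  assumes "j \<le> n"
  shows "\<P>(\<omega> in M. (\<forall>s\<le>k. X s \<omega> = x s) \<and> X (Suc k) \<omega> = j) =
    \<P>(\<omega> in M. \<forall>s\<le>k. X s \<omega> = x s) * P $$ (x k, j)"
proof (cases "\<P>(\<omega> in M. \<forall>s\<le>k. X s \<omega> = x s) = 0")
  case True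
  have "\<P>(\<omega> in M. (\<forall>s\<le>k. X s \<omega> = x s) \<and> X (Suc k) \<omega> = j) \<le> \<P>(\<omega> in M. \<forall>s\<le>k. X s \<omega> = x s)"
    by (intro finite_measure_mono) auto
  thus ?thesis using True by (simp add: measure_le_0_iff)
next
  case False
  hence "\<P>(\<omega> in M. X (Suc k) \<omega> = j \<bar> \<forall>s\<le>k. X s \<omega> = x s) = P $$ (x k, j)"
    using chain assms by (simp add: markov_chain_def)
  thus ?thesis using False by (simp add: cond_prob_def field_simps conj_commute)
qed

text \<open>Paths are extensional functions on \<open>{..k}\<close>, so different paths differ at
  some time up to \<open>k\<close> and their cylinder events are disjoint.\<close>

lemma sum_paths:
  assumes Q [measurable]: "Measurable.pred M Q" and S: "finite S" "S \<subseteq> (\<Pi>\<^sub>E s\<in>{..k}. UNIV)"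
  shows "\<P>(\<omega> in M. (\<exists>x\<in>S. \<forall>s\<le>k. X s \<omega> = x s) \<and> Q \<omega>) =
    (\<Sum>x\<in>S. \<P>(\<omega> in M. (\<forall>s\<le>k. X s \<omega> = x s) \<and> Q \<omega>))"
proof -
  let ?E = "\<lambda>x. {\<omega>\<in>space M. (\<forall>s\<le>k. X s \<omega> = x s) \<and> Q \<omega>}"
  have "{\<omega>\<in>space M. (\<exists>x\<in>S. \<forall>s\<le>k. X s \<omega> = x s) \<and> Q \<omega>} = (\<Union>x\<in>S. ?E x)" by auto
  moreover have "disjoint_family_on ?E S"
    unfolding disjoint_family_on_def
  proof (intro ballI impI)
    fix x y assume xy: "x \<in> S" "y \<in> S" "x \<noteq> y"
    have "\<exists>s\<le>k. x s \<noteq> y s"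
    proof (rule ccontr)
      assume "\<not> ?thesis"
      moreover have "x \<in> (\<Pi>\<^sub>E s\<in>{..k}. UNIV)" "y \<in> (\<Pi>\<^sub>E s\<in>{..k}. UNIV)" using xy S by auto
      ultimately have "x = y" by (intro PiE_ext) auto
      thus False using xy by simp
    qed
    thus "?E x \<inter> ?E y = {}" by auto
  qed
  ultimately show ?thesis using S(1) by (simp add: finite_measure_finite_Union image_subset_iff)
qed

text \<open>Avoiding 0 up to time \<open>k\<close> means following one of finitely many paths in
  \<open>{1..n}\<close>. Apply the Markov property to each and group the paths by their
  endpoint.\<close>

lemma taboo_step:
  assumes "j \<le> n"
  shows "\<P>(\<omega> in M. (\<forall>s\<le>k. X s \<omega> \<noteq> 0) \<and> X (Suc k) \<omega> = j) = (\<Sum>i\<le>n. taboo k i * P $$ (i, j))"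
proof -
  define S where "S = (\<Pi>\<^sub>E s\<in>{..k}. {1..n})"
  have S: "finite S" "S \<subseteq> (\<Pi>\<^sub>E s\<in>{..k}. UNIV)" by (auto simp: S_def intro!: finite_PiE)
  have avoid: "(\<forall>s\<le>k. X s \<omega> \<noteq> 0) \<longleftrightarrow> (\<exists>x\<in>S. \<forall>s\<le>k. X s \<omega> = x s)" if "\<omega> \<in> space M" for \<omega>
  proof
    assume "\<forall>s\<le>k. X s \<omega> \<noteq> 0"
    hence "restrict (\<lambda>s. X s \<omega>) {..k} \<in> S" using X_le[OF that] by (auto simp: S_def Suc_le_eq)
    thus "\<exists>x\<in>S. \<forall>s\<le>k. X s \<omega> = x s" by (intro bexI[of _ "restrict (\<lambda>s. X s \<omega>) {..k}"]) auto
  next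
    assume "\<exists>x\<in>S. \<forall>s\<le>k. X s \<omega> = x s"
    then obtain x where x: "x \<in> S" "\<And>s. s \<le> k \<Longrightarrow> X s \<omega> = x s" by auto
    have "x s \<in> {1..n}" if "s \<le> k" for s using x(1) that by (auto simp: S_def PiE_iff)
    thus "\<forall>s\<le>k. X s \<omega> \<noteq> 0" using x(2) by force
  qed
  let ?C = "\<lambda>x. \<P>(\<omega> in M. \<forall>s\<le>k. X s \<omega> = x s)"
  have taboo: "taboo k i = (\<Sum>x\<in>{x\<in>S. x k = i}. ?C x)" for i
  proof -
    have "taboo k i = \<P>(\<omega> in M. (\<exists>x\<in>S. \<forall>s\<le>k. X s \<omega> = x s) \<and> X k \<omega> = i)"
      unfolding taboo_def
      by (intro arg_cong[of _ _ "measure M"] Collect_cong conj_cong refl avoid)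
    also have "\<dots> = (\<Sum>x\<in>S. \<P>(\<omega> in M. (\<forall>s\<le>k. X s \<omega> = x s) \<and> X k \<omega> = i))"
      by (rule sum_paths[OF _ S]) measurable
    also have "\<dots> = (\<Sum>x\<in>S. if x k = i then ?C x else 0)"
    proof (intro sum.cong refl)
      fix x
      show "\<P>(\<omega> in M. (\<forall>s\<le>k. X s \<omega> = x s) \<and> X k \<omega> = i) = (if x k = i then ?C x else 0)"
      proof (cases "x k = i")
        case True
        thus ?thesis by (auto intro!: arg_cong[of _ _ "measure M"])
      next
        case False
        hence "{\<omega>\<in>space M. (\<forall>s\<le>k. X s \<omega> = x s) \<and> X k \<omega> = i} = {}" by auto
        thus ?thesis using False by (metis measure_empty)
      qed
    qed
    also have "\<dots> = (\<Sum>x\<in>{x\<in>S. x k = i}. ?C x)" using S by (intro sum.inter_filter[symmetric])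
    finally show ?thesis .
  qed
  have "\<P>(\<omega> in M. (\<forall>s\<le>k. X s \<omega> \<noteq> 0) \<and> X (Suc k) \<omega> = j) =
      \<P>(\<omega> in M. (\<exists>x\<in>S. \<forall>s\<le>k. X s \<omega> = x s) \<and> X (Suc k) \<omega> = j)"
    by (intro arg_cong[of _ _ "measure M"] Collect_cong conj_cong refl avoid)
  also have "\<dots> = (\<Sum>x\<in>S. \<P>(\<omega> in M. (\<forall>s\<le>k. X s \<omega> = x s) \<and> X (Suc k) \<omega> = j))"
    by (rule sum_paths[OF _ S]) measurable
  also have "\<dots> = (\<Sum>x\<in>S. ?C x * P $$ (x k, j))" by (simp only: path_step[OF assms])
  also have "\<dots> = (\<Sum>i\<le>n. \<Sum>x\<in>{x\<in>S. x k = i}. ?C x * P $$ (x k, j))"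
    using S by (intro sum.group[symmetric]) (auto simp: S_def PiE_iff)
  also have "\<dots> = (\<Sum>i\<le>n. taboo k i * P $$ (i, j))"
    unfolding taboo sum_distrib_right by (intro sum.cong) auto
  finally show ?thesis .
qed

lemma taboo_0: "taboo k 0 = 0"
proof -
  have "{\<omega> \<in> space M. (\<forall>s\<le>k. X s \<omega> \<noteq> 0) \<and> X k \<omega> = 0} = {}" by auto
  thus ?thesis by (simp only: taboo_def measure_empty)
qed

lemma first_hit_Suc: "first_hit (Suc k) = (\<Sum>i\<le>n. taboo k i * P $$ (i, 0))"
  unfolding taboo_step[OF le0, symmetric] first_hit_def less_Suc_eq_le ..

lemma taboo_Suc:
  assumes "j \<le> n" "j \<noteq> 0"
  shows "taboo (Suc k) j = (\<Sum>i\<le>n. taboo k i * P $$ (i, j))"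
proof -
  have "taboo (Suc k) j = \<P>(\<omega> in M. (\<forall>s\<le>k. X s \<omega> \<noteq> 0) \<and> X (Suc k) \<omega> = j)"
    unfolding taboo_def using assms(2) by (intro arg_cong[of _ _ "measure M"]) (auto simp: le_Suc_eq)
  thus ?thesis by (simp only: taboo_step[OF assms(1)])
qed

text \<open>The law at time \<open>k\<close>, which is \<open>\<pi>\<close>, decomposed by the time of the first visit to \<open>0\<close>.\<close>

lemma first_passage_decomposition:
  assumes "j \<le> n"
  shows "\<pi> j = taboo k j + (\<Sum>s\<le>k. first_hit s * (P ^\<^sub>m (k - s)) $$ (0, j))"
  using assms
proof (induction k arbitrary: j)
  case 0
  have X0: "\<P>(\<omega> in M. X 0 \<omega> = j) = \<pi> j" using chain 0 by (simp add: markov_chain_def)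
  show ?case
  proof (cases "j = 0")
    case True
    thus ?thesis using X0 pow_mat_0_index[OF carrier, of 0 0]
      by (simp add: taboo_0 first_hit_def del: pow_mat.simps)
  next
    case False
    have "taboo 0 j = \<P>(\<omega> in M. X 0 \<omega> = j)"
      unfolding taboo_def using False by (intro arg_cong[of _ _ "measure M"]) auto
    thus ?thesis using X0 pow_mat_0_index[OF carrier, of 0 j] 0 False
      by (simp del: pow_mat.simps)
  qed
next
  case (Suc k)
  \<comment> \<open>Mass arriving at \<open>j\<close> at time \<open>Suc k\<close> is a first visit
    if \<open>j = 0\<close> and taboo mass otherwise; the zeroth power supplies the indicator of
    \<open>j = 0\<close>.\<close>
  have step: "(\<Sum>i\<le>n. taboo k i * P $$ (i, j)) =
      taboo (Suc k) j + first_hit (Suc k) * (P ^\<^sub>m 0) $$ (0, j)"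
    using Suc.prems pow_mat_0_index[OF carrier, of 0 j]
    by (cases "j = 0") (simp_all add: taboo_0 first_hit_Suc taboo_Suc del: pow_mat.simps)
  have "\<pi> j = (\<Sum>i\<le>n. (taboo k i + (\<Sum>s\<le>k. first_hit s * (P ^\<^sub>m (k - s)) $$ (0, i))) * P $$ (i, j))"
    unfolding \<pi>_P[OF Suc.prems, symmetric] by (intro sum.cong refl) (simp only: Suc.IH atMost_iff)
  also have "\<dots> = (\<Sum>i\<le>n. taboo k i * P $$ (i, j)) +
      (\<Sum>i\<le>n. \<Sum>s\<le>k. first_hit s * ((P ^\<^sub>m (k - s)) $$ (0, i) * P $$ (i, j)))"
    by (simp add: distrib_right sum.distrib sum_distrib_right mult.assoc)
  also have "(\<Sum>i\<le>n. \<Sum>s\<le>k. first_hit s * ((P ^\<^sub>m (k - s)) $$ (0, i) * P $$ (i, j))) =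
      (\<Sum>s\<le>k. first_hit s * (P ^\<^sub>m (Suc k - s)) $$ (0, j))"
    by (subst sum.swap, intro sum.cong refl)
      (simp add: Suc_diff_le pow_mat_Suc_index[OF carrier] Suc.prems sum_distrib_left del: pow_mat.simps)
  finally show ?case unfolding step by (simp del: pow_mat.simps)
qed

section \<open>The hitting time as a random variable\<close>

lemma hitting_time_zero_eq_enat:
  "hitting_time_zero X \<omega> = enat k \<longleftrightarrow> (\<forall>s<k. X s \<omega> \<noteq> 0) \<and> X k \<omega> = 0"
proof
  assume eq: "hitting_time_zero X \<omega> = enat k"
  have "{t. X t \<omega> = 0} \<noteq> {}"
  proof
    assume empty: "{t. X t \<omega> = 0} = {}"
    have "hitting_time_zero X \<omega> = \<infinity>" unfolding hitting_time_zero_def empty by (simp add: top_enat_def)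
    thus False using eq by simp
  qed
  \<comment> \<open>The infimum of a nonempty set of extended naturals is attained.\<close>
  hence "hitting_time_zero X \<omega> \<in> enat ` {t. X t \<omega> = 0}"
    unfolding hitting_time_zero_def by (intro wellorder_InfI[of "enat (SOME t. X t \<omega> = 0)"])
      (auto intro: someI)
  moreover have "X s \<omega> \<noteq> 0" if "s < k" for s
  proof
    assume "X s \<omega> = 0"
    hence "hitting_time_zero X \<omega> \<le> enat s" unfolding hitting_time_zero_def by (intro Inf_lower) auto
    thus False using eq that by simp
  qed
  ultimately show "(\<forall>s<k. X s \<omega> \<noteq> 0) \<and> X k \<omega> = 0" using eq by auto
next
  assume k: "(\<forall>s<k. X s \<omega> \<noteq> 0) \<and> X k \<omega> = 0"
  show "hitting_time_zero X \<omega> = enat k"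
    unfolding hitting_time_zero_def
  proof (rule antisym)
    show "Inf (enat ` {t. X t \<omega> = 0}) \<le> enat k" using k by (intro Inf_lower) auto
    show "enat k \<le> Inf (enat ` {t. X t \<omega> = 0})"
      using k by (intro Inf_greatest) (auto simp: not_less[symmetric])
  qed
qed

text \<open>The extended naturals are countable, so preimages of points suffice; that of \<infinity>
  is the complement of the others.\<close>

lemma hitting_time_zero_measurable [measurable]:
  "hitting_time_zero X \<in> measurable M (count_space UNIV)"
proof -
  have fin: "hitting_time_zero X -` {enat k} \<inter> space M \<in> sets M" for k
  proof -
    have "hitting_time_zero X -` {enat k} \<inter> space M =
        {\<omega>\<in>space M. (\<forall>s<k. X s \<omega> \<noteq> 0) \<and> X k \<omega> = 0}"
      by (auto simp: hitting_time_zero_eq_enat)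
    thus ?thesis by simp
  qed
  have "hitting_time_zero X -` {\<infinity>} \<inter> space M = space M - (\<Union>k. hitting_time_zero X -` {enat k} \<inter> space M)"
    by auto
  also have "\<dots> \<in> sets M" using fin by blast
  finally have "hitting_time_zero X -` {x} \<inter> space M \<in> sets M" for x
    using fin by (cases x) auto
  thus ?thesis by (simp add: measurable_count_space_eq2_countable)
qed

text \<open>As \<open>q\<close> has total mass one, the finite values already carry full mass under
  the law of the hitting time, and nothing is left for \<infinity>.\<close>

lemma distr_hitting_time_zero:
  assumes "\<And>k. first_hit k = pmf q k"
  shows "distr M (count_space UNIV) (hitting_time_zero X) = measure_pmf (map_pmf enat q)"
proof -
  let ?D = "distr M (count_space UNIV) (hitting_time_zero X)" and ?N = "measure_pmf (map_pmf enat q)"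
  interpret D: prob_space ?D by (rule prob_space_distr) simp
  have singleton: "emeasure ?D {enat k} = emeasure ?N {enat k}" for k
  proof -
    have "emeasure ?D {enat k} = emeasure M {\<omega>\<in>space M. (\<forall>s<k. X s \<omega> \<noteq> 0) \<and> X k \<omega> = 0}"
      by (subst emeasure_distr) (auto simp: hitting_time_zero_eq_enat intro!: arg_cong[of _ _ "emeasure M"])
    also have "\<dots> = ennreal (pmf q k)"
      using assms[of k] by (simp add: emeasure_eq_measure first_hit_def)
    also have "\<dots> = emeasure ?N {enat k}"
      by (simp add: emeasure_pmf_single pmf_map_inj' inj_on_def)
    finally show ?thesis .
  qed
  have N: "AE x in ?N. x \<in> range enat" by (simp add: AE_measure_pmf_iff)
  have "emeasure ?D (range enat) = (\<integral>\<^sup>+x. emeasure ?D {x} \<partial>count_space (range enat))"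
    by (intro emeasure_countable_singleton) auto
  also have "\<dots> = (\<integral>\<^sup>+x. emeasure ?N {x} \<partial>count_space (range enat))"
    using singleton by (intro nn_integral_cong) auto
  also have "\<dots> = emeasure ?N (range enat)"
    by (intro emeasure_countable_singleton[symmetric]) auto
  also have "\<dots> = 1"
    using N by (intro measure_pmf.emeasure_eq_1_AE) auto
  finally have "D.prob (range enat) = 1" by (simp add: D.emeasure_eq_measure)
  hence D: "AE x in ?D. x \<in> range enat" by (subst (asm) D.prob_eq_1) auto
  show ?thesis
    by (rule measure_eqI_countable_AE[of _ _ "range enat"]) (use D N singleton in auto)
qed

end

section \<open>The law of the hitting time\<close>

lemma const_series_mult_one_minus_X:
  "Abs_fps (\<lambda>_. c) * (1 - fps_X) = fps_const (c :: real)"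
proof (rule fps_ext)
  fix k
  have "Abs_fps (\<lambda>_. c) * (1 - fps_X) = Abs_fps (\<lambda>_. c) - fps_X * Abs_fps (\<lambda>_. c)"
    by (simp add: algebra_simps)
  thus "fps_nth (Abs_fps (\<lambda>_. c) * (1 - fps_X)) k = fps_nth (fps_const c) k"
    by (cases k) simp_all
qed

lemma prod_fps_const: "(\<Prod>i\<in>I. fps_const (f i)) = fps_const (\<Prod>i\<in>I. f i :: 'a :: comm_ring_1)"
  by (induction I rule: infinite_finite_induct) auto

lemma sorted_list_of_multiset_image_decreasing:
  fixes g :: "nat \<Rightarrow> real"
  assumes "\<And>i j. 1 \<le> i \<Longrightarrow> i < j \<Longrightarrow> j \<le> r \<Longrightarrow> g j < g i"
  shows "rev (sorted_list_of_multiset (image_mset g (mset_set {1..r}))) = map g [1..<Suc r]"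
proof -
  have "sorted (rev (map g [1..<Suc r]))"
    unfolding sorted_rev_iff_nth_mono
  proof (intro allI impI)
    fix i j assume "i \<le> j" "j < length (map g [1..<Suc r])"
    thus "map g [1..<Suc r] ! j \<le> map g [1..<Suc r] ! i"
      using assms[of "Suc i" "Suc j"] by (cases "i = j") (auto simp del: upt_Suc intro: less_imp_le)
  qed
  hence "sorted_list_of_multiset (mset (rev (map g [1..<Suc r]))) = rev (map g [1..<Suc r])"
    unfolding sorted_list_of_multiset_mset by (rule sorted_sort_id)
  moreover have "mset (rev (map g [1..<Suc r])) = image_mset g (mset_set {1..r})"
    by (simp add: atLeastLessThanSuc_atLeastAtMost del: upt_Suc)
  ultimately show ?thesis by (metis rev_rev_ident)
qed

theorem theorem3p2:
  fixes n :: nat and P :: "real mat" and \<pi> :: "nat \<Rightarrow> real"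
    and M :: "'w measure" and X :: "nat \<Rightarrow> 'w \<Rightarrow> nat"
  assumes "n \<ge> 1"
    and "ergodic_matrix n P"
    and "stationary_distribution n P \<pi>"
    and "time_reversible n P \<pi>"
    and "markov_chain n P \<pi> M X"
    and "reduced_lambda P (num_reduced P) \<ge> 0"
  shows "distr M (count_space UNIV) (hitting_time_zero X) =
    measure_pmf (map_pmf (\<lambda>Y. enat (\<Sum>i\<in>{1..num_reduced P}. Y i))
      (Pi_pmf {1..num_reduced P} 0
        (\<lambda>i. modified_geometric (reduced_gamma P i) (reduced_lambda P i))))"
proof -
  interpret chain: stationary_markov_chain n P \<pi> M X
    using assms by unfold_locales (auto simp: ergodic_matrix_def)
  interpret reversible_operator n "\<lambda>i j. P $$ (i, j)" \<pi>
    using assms(4) chain.\<pi>_pos by unfold_locales (auto simp: time_reversible_def)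
  obtain L :: "real set" and u where fin: "finite L"
    and eig: "\<And>\<mu> i. \<mu> \<in> L \<Longrightarrow> i \<le> n \<Longrightarrow> (\<Sum>j\<le>n. P $$ (i, j) * u \<mu> j) = \<mu> * u \<mu> i"
    and sum_u: "\<And>i. i \<le> n \<Longrightarrow> (\<Sum>\<mu>\<in>L. u \<mu> i) = (if i = 0 then 1 else 0)"
    and u_pos: "\<And>\<mu>. \<mu> \<in> L \<Longrightarrow> 0 < u \<mu> 0"
    using eigenvector_expansion by blast
  interpret W: positive_partial_fraction L "\<lambda>\<mu>. u \<mu> 0"
    using fin u_pos sum_u[of 0] by unfold_locales auto
  obtain r l g where card_L: "card L = Suc r" and L: "L = l ` {..r}"
    and l_nth: "\<And>i. i \<le> r \<Longrightarrow> rev (sorted_list_of_set L) ! i = l i"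
    and l_less: "\<And>i j. i < j \<Longrightarrow> j \<le> r \<Longrightarrow> l j < l i"
    and g: "\<And>i. i \<in> {1..r} \<Longrightarrow> l i < g i \<and> g i < l (i - 1)"
    and numer: "W.numer = (\<Prod>i\<in>{1..r}. [:- g i, 1:])"
    using W.interlacing by blast

  have g_less: "g j < g i" if "1 \<le> i" "i < j" "j \<le> r" for i j
  proof -
    have "g j < l (j - 1)" "l i < g i" using g that by auto
    moreover have "i = j - 1 \<or> i < j - 1 \<and> j - 1 \<le> r" using that by auto
    hence "l (j - 1) \<le> l i" using l_less[of i "j - 1"] by auto
    ultimately show ?thesis by simp
  qed
  have p_neq_0: "char_poly P \<noteq> 0" "char_poly (delete_zero P) \<noteq> 0"
    using degree_monic_char_poly[OF chain.carrier]
      degree_monic_char_poly[OF mat_delete_carrier[OF chain.carrier, of 0 0]] by auto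
  have "poly (char_poly (delete_zero P)) z = poly (char_poly P) z * (\<Sum>\<mu>\<in>L. u \<mu> 0 / (z - \<mu>))"
    if "z \<notin> L" for z
    by (rule char_poly_delete_eq[OF chain.carrier refl eig sum_u that])
  note reduced = W.proots_diff_common[OF p_neq_0 this]
  have lambdas: "reduced_lambdas P = mset_set L"
    using reduced(1) by (simp add: reduced_lambdas_def common_eigenvalues_def eigenvalue_mset_def)
  have gammas: "reduced_gammas P = image_mset g (mset_set {1..r})"
  proof -
    have "proots W.numer = (\<Sum>i\<in>{1..r}. {#g i#})"
      unfolding numer by (subst proots_prod) auto
    thus ?thesis
      using reduced(2) by (simp add: reduced_gammas_def common_eigenvalues_def eigenvalue_mset_def
          sum_unfold_sum_mset)
  qed
  have num: "num_reduced P = r" by (simp add: num_reduced_def gammas)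
  have lambda: "reduced_lambda P i = l i" if "i \<le> r" for i
    using l_nth[OF that] by (simp add: reduced_lambda_def lambdas)
  have gamma: "reduced_gamma P i = g i" if "i \<in> {1..r}" for i
  proof -
    have "rev (sorted_list_of_multiset (reduced_gammas P)) = map g [1..<Suc r]"
      unfolding gammas using g_less by (rule sorted_list_of_multiset_image_decreasing)
    moreover have "i - 1 < r" "1 + (i - 1) = i" using that by auto
    ultimately show ?thesis by (simp add: reduced_gamma_def del: upt_Suc)
  qed

  have one: "1 \<in> L" and u_1: "u 1 0 = \<pi> 0"
    using chain.unit_eigenvalue[OF fin eig sum_u] by auto
  have l_le_1: "l i \<le> 1" if "i \<le> r" for i
    using chain.eigenvalue_le_1[OF eig u_pos, of "l i"] that L by auto
  \<comment> \<open>The eigenvalue 1 occurs in \<open>L\<close> and none exceeds it, so it is the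
    first in the decreasing order.\<close>
  have l_0: "l 0 = 1"
  proof -
    obtain j where "j \<le> r" "l j = 1" using one L by auto
    thus ?thesis using l_less[of 0 j] l_le_1[of 0] by (cases "j = 0") auto
  qed
  have inj: "inj_on l {..r}"
    by (rule inj_onI) (metis atMost_iff l_less less_irrefl linorder_neqE_nat)
  have L_minus_1: "L - {1} = l ` {1..r}"
  proof -
    have "{1..r} = {..r} - {0}" by auto
    moreover have "l ` ({..r} - {0}) = l ` {..r} - l ` {0}"
      using inj by (intro inj_on_image_set_diff) auto
    ultimately show ?thesis using L l_0 by simp
  qed
  have inj': "inj_on l {1..r}" using inj by (rule inj_on_subset) auto
  \<comment> \<open>Nonnegativity of the last reduced eigenvalue of \<open>P\<close> enters here:
    with interlacing it makes the parameters of \<open>modified_geometric\<close>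
    admissible.\<close>
  have g_bounds: "0 \<le> g i" "g i < 1" "l i \<le> g i" if "i \<in> {1..r}" for i
  proof -
    have "0 \<le> l r" using assms(6) lambda[of r] by (simp add: num)
    also have "l r \<le> l i" using l_less[of i r] that by (cases "i = r") auto
    finally show "0 \<le> g i" "l i \<le> g i" using g[OF that] by auto
    have "i - 1 \<le> r" using that by auto
    from l_le_1[OF this] show "g i < 1" using g[OF that] by simp
  qed

  \<comment> \<open>The generating function of the hitting time; its coefficients are not yet known
    to sum to one.\<close>
  define A where "A = Abs_fps chain.first_hit"
  define Q where "Q = map_pmf (\<lambda>Y. \<Sum>i\<in>{1..r}. Y i)
    (Pi_pmf {1..r} 0 (\<lambda>i. modified_geometric (g i) (l i)))"
  let ?G = "\<Prod>i\<in>{1..r}. 1 - fps_const (g i) * fps_X"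
  let ?L = "\<Prod>i\<in>{1..r}. 1 - fps_const (l i) * fps_X"
  define m where "m = Abs_fps (\<lambda>k. (P ^\<^sub>m k) $$ (0, 0))"

  \<comment> \<open>Apply the powers of \<open>P\<close> to the eigenvector expansion and read off
    the entry at 0.\<close>
  have "m = Abs_fps (\<lambda>k. \<Sum>\<mu>\<in>L. u \<mu> 0 * \<mu> ^ k)"
  proof (rule fps_ext)
    fix k
    have "(P ^\<^sub>m k) $$ (0, 0) = (\<Sum>j\<le>n. (P ^\<^sub>m k) $$ (0, j) * (if j = 0 then 1 else 0))"
      by (simp add: if_distrib cong: if_cong)
    also have "\<dots> = (\<Sum>j\<le>n. (P ^\<^sub>m k) $$ (0, j) * (\<Sum>\<mu>\<in>L. u \<mu> j))"
      by (intro sum.cong refl) (simp add: sum_u)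
    also have "\<dots> = (\<Sum>\<mu>\<in>L. \<Sum>j\<le>n. (P ^\<^sub>m k) $$ (0, j) * u \<mu> j)"
      unfolding sum_distrib_left by (rule sum.swap)
    also have "\<dots> = (\<Sum>\<mu>\<in>L. \<mu> ^ k * u \<mu> 0)"
      by (intro sum.cong refl pow_mat_eigenvector[OF chain.carrier eig]) auto
    finally show "fps_nth m k = fps_nth (Abs_fps (\<lambda>k. \<Sum>\<mu>\<in>L. u \<mu> 0 * \<mu> ^ k)) k"
      by (simp add: m_def mult.commute)
  qed
  hence "m * (\<Prod>\<mu>\<in>L. 1 - fps_const \<mu> * fps_X) = ?G"
    using W.power_sums_mult_linear_factors[OF numer] card_L by simp
  \<comment> \<open>The pole at 1 contributes the factor \<open>1 - fps_X\<close>, which will cancel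
    against the constant series \<open>\<pi> 0\<close>.\<close>
  also have "(\<Prod>\<mu>\<in>L. 1 - fps_const \<mu> * fps_X) = (1 - fps_X) * ?L"
    unfolding prod.remove[OF fin one] L_minus_1 prod.reindex[OF inj'] by simp
  finally have m: "m * ((1 - fps_X) * ?L) = ?G" .
  \<comment> \<open>At state 0 the taboo term vanishes, so the first passage decomposition is a
    convolution identity.\<close>
  have "A * m = Abs_fps (\<lambda>_. \<pi> 0)"
    using chain.first_passage_decomposition[of 0]
    by (intro fps_ext) (simp add: A_def m_def fps_mult_nth chain.taboo_0 atLeast0AtMost)
  hence "A * m * (1 - fps_X) * ?L = fps_const (\<pi> 0) * ?L"
    by (simp only: const_series_mult_one_minus_X)
  hence A: "A * ?G = fps_const (\<pi> 0) * ?L"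
    by (simp only: m[symmetric] mult.assoc)

  \<comment> \<open>Evaluate \<open>W.numer\<close> at the pole 1 in two ways: through its roots,
    and through the weight at that pole, which is \<open>\<pi> 0\<close>.\<close>
  have "(\<Prod>i\<in>{1..r}. 1 - g i) = poly W.numer 1"
    by (simp add: numer poly_prod)
  also have "\<dots> = \<pi> 0 * (\<Prod>i\<in>{1..r}. 1 - l i)"
    unfolding W.poly_numer_pole[OF one] u_1 L_minus_1 prod.reindex[OF inj'] by simp
  finally have eq: "(\<Prod>i\<in>{1..r}. 1 - g i) = \<pi> 0 * (\<Prod>i\<in>{1..r}. 1 - l i)" .
  have weights: "(\<Prod>i\<in>{1..r}. (1 - g i) / (1 - l i)) = \<pi> 0"
  proof -
    have "l i \<noteq> 1" if "i \<in> {1..r}" for i using g_bounds[OF that] by simp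
    hence "(\<Prod>i\<in>{1..r}. 1 - l i) \<noteq> 0" by auto
    thus ?thesis by (simp only: prod_dividef eq nonzero_mult_div_cancel_right not_False_eq_True)
  qed
  have "pmf_fps Q * ?G =
      (\<Prod>i\<in>{1..r}. pmf_fps (modified_geometric (g i) (l i)) * (1 - fps_const (g i) * fps_X))"
    by (simp add: Q_def pmf_fps_Pi_pmf_sum prod.distrib)
  also have "\<dots> = (\<Prod>i\<in>{1..r}. fps_const ((1 - g i) / (1 - l i)) * (1 - fps_const (l i) * fps_X))"
    by (intro prod.cong refl pmf_fps_modified_geometric g_bounds)
  also have "\<dots> = fps_const (\<pi> 0) * ?L"
    by (simp only: prod.distrib prod_fps_const weights)
  finally have "A * ?G = pmf_fps Q * ?G" using A by simp
  \<comment> \<open>Each factor has constant coefficient one, so \<open>?G\<close> can be cancelled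
    in the integral domain of power series.\<close>
  moreover have "?G \<noteq> 0"
  proof -
    have "1 - fps_const c * fps_X \<noteq> 0" for c :: real
    proof
      assume "1 - fps_const c * fps_X = 0"
      hence "fps_nth (1 - fps_const c * fps_X) 0 = 0" by simp
      thus False by simp
    qed
    thus ?thesis by simp
  qed
  ultimately have "A = pmf_fps Q" by simp
  hence "chain.first_hit k = pmf Q k" for k
    by (simp add: A_def pmf_fps_def fps_eq_iff)
  hence "distr M (count_space UNIV) (hitting_time_zero X) = measure_pmf (map_pmf enat Q)"
    by (rule chain.distr_hitting_time_zero)
  also have "map_pmf enat Q = map_pmf (\<lambda>Y. enat (\<Sum>i\<in>{1..r}. Y i))
      (Pi_pmf {1..r} 0 (\<lambda>i. modified_geometric (g i) (l i)))"
    by (simp add: Q_def map_pmf_comp)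
  also have "Pi_pmf {1..r} 0 (\<lambda>i. modified_geometric (g i) (l i)) =
      Pi_pmf {1..r} 0 (\<lambda>i. modified_geometric (reduced_gamma P i) (reduced_lambda P i))"
    by (rule Pi_pmf_cong) (auto simp: gamma lambda)
  finally show ?thesis by (simp only: num)
qed

end
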